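(* Let $A$ be a connected graph whose vertex set is partitioned as $V(A)=A^1\cup A^2\cup\cdots\cup A^m$, where for each $i$ the number $|A^i|$ is even, the subgraph of $A$ induced by $A^i$ is $d_i$-regular for some $d_i\geq |A^i|/2$, and each vertex $a\in A^i$ is adjacent (in $A$) to all or none of the vertices of $A^j$, for each $j\neq i$. For each $i\in\{1,\dots,m\}$ let $B^i$ be a collection of connected graphs $B^i_1,\dots,B^i_{\ell_i}$ (pairwise vertex-disjoint and vertex-disjoint from $A$), and for each $B^i_j$ select a subset $A^i_j\subseteq A^i$ with $|A^i_j|=|A^i|/2$. Let $G_1$ be a connected graph with vertex set $V(A)\cup\bigcup_{i,j}V(B^i_j)$ whose edges are the edges of $A$, the edges of the graphs $B^i_j$, and edges between vertices of $B^i_j$ and vertices of $A^i$, such that each vertex $b\in V(B^i_j)$ is adjacent to none of the vertices of $A^i$, to all of them, or to exactly the vertices of $A^i_j$. Let $G_2$ be the graph obtained from $G_1$ by replacing, for each vertex $b\in V(B^i_j)$ whose set of neighbors in $A^i$ is exactly $A^i_j$, these edges by edges from $b$ to every vertex of $A^i\setminus A^i_j$ (all other edges unchanged), and assume $G_2$ is connected. Then $G_1$ and $G_2$ are cospectral for the distance matrix.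
   Context: For a connected graph $G$, the distance $\mathrm{dist}(u,v)$ is the number of edges of a shortest path between $u$ and $v$. The distance matrix $\mathcal{D}^G$ has $(u,v)$ entry $\mathrm{dist}(u,v)$. Two graphs are cospectral for a matrix representation if their matrices have the same multiset of eigenvalues. A graph is $d$-regular if every vertex has degree $d$. *)

theory Defs
  imports
    "Graph_Theory.Graph_Theory"
    "Jordan_Normal_Form.Char_Poly"
    "HOL-Computational_Algebra.Fundamental_Theorem_Algebra"
    "HOL-Library.Disjoint_Sets"
begin

text \<open>
  A finite simple graph is a \<^locale>\<open>pair_graph\<close>: a finite loop-free digraph whose arc relation
  is symmetric, so an undirected edge \<open>uv\<close> is the pair of arcs \<open>(u, v)\<close> and \<open>(v, u)\<close>.
  The library's \<^const>\<open>Digraph_Component.connected\<close> includes non-emptiness of the vertex set.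
\<close>

definition neighbors :: "'a pair_pre_digraph \<Rightarrow> 'a \<Rightarrow> 'a set" where
  "neighbors G u = {v. (u, v) \<in> parcs G}"

text \<open>In a symmetric digraph the out-degree is the degree of the undirected graph.\<close>

definition regular_graph :: "('a, 'b) pre_digraph \<Rightarrow> nat \<Rightarrow> bool" where
  "regular_graph G d \<longleftrightarrow> (\<forall>v \<in> verts G. out_degree G v = d)"

definition graph_dist :: "'a pair_pre_digraph \<Rightarrow> 'a \<Rightarrow> 'a \<Rightarrow> nat" where
  "graph_dist G u v = (LEAST n. \<exists>p. pre_digraph.apath (with_proj G) u p v \<and> length p = n)"

text \<open>
  Matrices are indexed by natural numbers, so the rows and columns of the distance matrix are
  ordered by an enumeration \<open>vs\<close> of the vertices.
\<close>

definition distance_matrix :: "'a pair_pre_digraph \<Rightarrow> 'a list \<Rightarrow> complex mat" where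
  "distance_matrix G vs =
     mat (length vs) (length vs) (\<lambda>(r, c). of_nat (graph_dist G (vs ! r) (vs ! c)))"

definition vertex_enumeration :: "'a pair_pre_digraph \<Rightarrow> 'a list \<Rightarrow> bool" where
  "vertex_enumeration G vs \<longleftrightarrow> distinct vs \<and> set vs = pverts G"

definition eigenvalue_mset :: "complex mat \<Rightarrow> complex multiset" where
  "eigenvalue_mset M = proots (char_poly M)"

lemma set_eigenvalue_mset:
  assumes "M \<in> carrier_mat n n"
  shows "set_mset (eigenvalue_mset M) = {k. eigenvalue M k}"
proof -
  have "char_poly M \<noteq> 0"
    using degree_monic_char_poly[OF assms] by auto
  then show ?thesis
    by (auto simp: eigenvalue_mset_def eigenvalue_root_char_poly[OF assms])
qed

definition distance_cospectral :: "'a pair_pre_digraph \<Rightarrow> 'b pair_pre_digraph \<Rightarrow> bool" where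
  "distance_cospectral G H \<longleftrightarrow>
     (\<forall>vs ws. vertex_enumeration G vs \<longrightarrow> vertex_enumeration H ws \<longrightarrow>
        eigenvalue_mset (distance_matrix G vs) = eigenvalue_mset (distance_matrix H ws))"

definition half_vertices :: "'a pair_pre_digraph \<Rightarrow> 'a set \<Rightarrow> 'a set \<Rightarrow> 'a set \<Rightarrow> 'a set" where
  "half_vertices G C S T = {b \<in> C. neighbors G b \<inter> S = T}"

definition sym_arcs :: "'a rel \<Rightarrow> 'a rel" where
  "sym_arcs R = R \<union> R\<inverse>"

text \<open>
  \<open>P i\<close> is the \<open>i\<close>-th part of the base graph, \<open>B i 1, \<dots>, B i (l i)\<close> are the graphs attached to it,
  and \<open>H i j\<close> is the half of \<open>P i\<close> selected for \<open>B i j\<close>.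
\<close>

definition switched_graph ::
  "nat \<Rightarrow> (nat \<Rightarrow> nat) \<Rightarrow> (nat \<Rightarrow> 'a set) \<Rightarrow> (nat \<Rightarrow> nat \<Rightarrow> 'a pair_pre_digraph) \<Rightarrow>
   (nat \<Rightarrow> nat \<Rightarrow> 'a set) \<Rightarrow> 'a pair_pre_digraph \<Rightarrow> 'a pair_pre_digraph" where
  "switched_graph m l P B H G =
     \<lparr> pverts = pverts G,
       parcs =
         (parcs G - sym_arcs (\<Union>i\<in>{1..m}. \<Union>j\<in>{1..l i}.
            half_vertices G (pverts (B i j)) (P i) (H i j) \<times> H i j))
         \<union> sym_arcs (\<Union>i\<in>{1..m}. \<Union>j\<in>{1..l i}.
            half_vertices G (pverts (B i j)) (P i) (H i j) \<times> (P i - H i j)) \<rparr>"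

end

theory Submission
  imports Defs
begin

text \<open>
  Let \<open>Q\<close> act as \<open>(2/n) J - I\<close> on each part of size \<open>n\<close> and as the identity on the attached
  vertices, so that \<open>Q\<close> is a symmetric involution. It fixes constant vectors on a part and
  exchanges the indicators of complementary halves. The degree condition gives every part diameter
  at most two and a neighbour in each half for every vertex outside it. Hence a detour through an
  attached graph never shortens a path between vertices of \<open>A\<close>: distances inside a part have
  constant row sums, and distances between different parts are constant. From an attached vertex, the distances
  to a part are constant or differ by one on two complementary halves, which the switching
  swaps. Distances between attached vertices do not change, because two halves meet if and only if
  their complements do. Together this gives \<open>Q D\<^sub>1 = D\<^sub>2 Q\<close> for the distance matrices.
\<close>

section \<open>Walks and distances\<close>

text \<open>An upper bound on the length rather than an exact length, because rerouting a walk may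
  shorten it.\<close>

definition walk_le :: "'a rel \<Rightarrow> nat \<Rightarrow> 'a \<Rightarrow> 'a \<Rightarrow> bool" where
  "walk_le E n u v \<longleftrightarrow> (\<exists>k\<le>n. (u, v) \<in> E ^^ k)"

text \<open>Distance through walks, which can be cut and spliced freely. For an unreachable pair the
  value carries no information, so reachability is supplied wherever it matters.\<close>

definition rel_dist :: "'a rel \<Rightarrow> 'a \<Rightarrow> 'a \<Rightarrow> nat" where
  "rel_dist E u v = (LEAST n. (u, v) \<in> E ^^ n)"

lemma walk_le_refl: "walk_le E n u u"
  unfolding walk_le_def by (intro exI[of _ 0]) auto

lemma walk_le_relpow: "(u, v) \<in> E ^^ n \<Longrightarrow> walk_le E n u v"
  unfolding walk_le_def by blast

lemma walk_le_arc: "(u, v) \<in> E \<Longrightarrow> walk_le E (Suc n) u v"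
  unfolding walk_le_def by (intro exI[of _ 1]) auto

lemma walk_le_mono: "walk_le E n u v \<Longrightarrow> n \<le> n' \<Longrightarrow> walk_le E n' u v"
  unfolding walk_le_def by (meson le_trans)

lemma walk_le_trans:
  assumes "walk_le E m u v" "walk_le E n v w"
  shows "walk_le E (m + n) u w"
proof -
  obtain k l where "k \<le> m" "l \<le> n" "(u, v) \<in> E ^^ k" "(v, w) \<in> E ^^ l"
    using assms unfolding walk_le_def by blast
  then have "(u, w) \<in> E ^^ (k + l)"
    unfolding relpow_add by blast
  with \<open>k \<le> m\<close> \<open>l \<le> n\<close> show ?thesis
    unfolding walk_le_def by (intro exI[of _ "k + l"]) auto
qed

lemma relpow_mono_rel:
  fixes E E' :: "'a rel"
  assumes "E \<subseteq> E'" shows "E ^^ n \<subseteq> E' ^^ n"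
proof (induction n)
  case (Suc n)
  then show ?case using assms unfolding relpow.simps by (rule relcomp_mono)
qed simp

lemma walk_le_mono_rel: "walk_le E n u v \<Longrightarrow> E \<subseteq> E' \<Longrightarrow> walk_le E' n u v"
  unfolding walk_le_def by (meson relpow_mono_rel subsetD)

lemma relpow_sym:
  assumes "sym E" "(u, v) \<in> E ^^ n" shows "(v, u) \<in> E ^^ n"
  using assms(2)
proof (induction n arbitrary: v)
  case (Suc n)
  then obtain z where "(u, z) \<in> E ^^ n" "(z, v) \<in> E"
    by auto
  then have "(v, z) \<in> E" "(z, u) \<in> E ^^ n" using Suc.IH symD[OF assms(1)] by simp_all
  then show ?case by (rule relpow_Suc_I2)
qed auto

lemma walk_le_sym: "sym E \<Longrightarrow> walk_le E n u v \<Longrightarrow> walk_le E n v u"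
  unfolding walk_le_def by (meson relpow_sym)

lemma rel_dist_le:
  assumes "walk_le E n u v" shows "rel_dist E u v \<le> n"
proof -
  obtain k where "k \<le> n" "(u, v) \<in> E ^^ k" using assms unfolding walk_le_def by blast
  then have "rel_dist E u v \<le> k" unfolding rel_dist_def by (intro Least_le)
  with \<open>k \<le> n\<close> show ?thesis by simp
qed

lemma relpow_rel_dist: "(u, v) \<in> E\<^sup>* \<Longrightarrow> (u, v) \<in> E ^^ rel_dist E u v"
  unfolding rel_dist_def by (rule LeastI_ex) (rule rtrancl_imp_relpow)

lemma rel_dist_sym:
  assumes "sym E" shows "rel_dist E u v = rel_dist E v u"
proof -
  have "(u, v) \<in> E ^^ n \<longleftrightarrow> (v, u) \<in> E ^^ n" for n
    using relpow_sym[OF assms] by blast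
  then show ?thesis unfolding rel_dist_def by simp
qed

text \<open>Cuts a walk at its first arc leaving \<open>S\<close>. The last premise excludes a walk
  of the same length inside \<open>S\<close>; it is guarded by \<open>w \<in> S\<close> since a walk
  ending elsewhere must leave. It serves both for \<open>S = V\<close> and for a single
  part.\<close>

lemma relpow_exit:
  assumes "(u, w) \<in> E ^^ n" "u \<in> S" "w \<in> S \<Longrightarrow> (u, w) \<notin> (E \<inter> S \<times> S) ^^ n"
  obtains k x y r where "n = Suc (k + r)" "(u, x) \<in> (E \<inter> S \<times> S) ^^ k" "x \<in> S"
    "(x, y) \<in> E" "y \<notin> S" "(y, w) \<in> E ^^ r"
proof -
  have "\<exists>k x y r. n = Suc (k + r) \<and> (u, x) \<in> (E \<inter> S \<times> S) ^^ k \<and> x \<in> S \<and>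
      (x, y) \<in> E \<and> y \<notin> S \<and> (y, w) \<in> E ^^ r"
    using assms
  proof (induction n arbitrary: u)
    case 0
    then show ?case by auto
  next
    case (Suc n)
    obtain z where z: "(u, z) \<in> E" "(z, w) \<in> E ^^ n"
      using Suc.prems(1) by (blast elim: relpow_Suc_E2)
    show ?case
    proof (cases "z \<in> S")
      case True
      have uz: "(u, z) \<in> E \<inter> S \<times> S"
        using z(1) Suc.prems(2) True by auto
      then have "w \<in> S \<Longrightarrow> (z, w) \<notin> (E \<inter> S \<times> S) ^^ n"
        using Suc.prems(3) relpow_Suc_I2 by metis
      then obtain k x y r where "n = Suc (k + r)" "(z, x) \<in> (E \<inter> S \<times> S) ^^ k" "x \<in> S"
          "(x, y) \<in> E" "y \<notin> S" "(y, w) \<in> E ^^ r"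
        using Suc.IH[of z] z(2) True by metis
      with uz show ?thesis
        by (intro exI[of _ "Suc k"] exI[of _ x] exI[of _ y] exI[of _ r])
          (auto intro: relpow_Suc_I2 simp del: relpow.simps)
    next
      case False
      then show ?thesis
        using z Suc.prems by (intro exI[of _ 0] exI[of _ u] exI[of _ z] exI[of _ n]) auto
    qed
  qed
  then show ?thesis using that by blast
qed

section \<open>From paths and connectedness of graphs to powers of the arc relation\<close>

lemma connected_imp_rtrancl:
  assumes "pair_wf_digraph G" "sym (parcs G)" "Digraph_Component.connected (with_proj G)"
    "u \<in> pverts G" "v \<in> pverts G"
  shows "(u, v) \<in> (parcs G)\<^sup>*"
proof -
  interpret pair_wf_digraph G by fact
  \<comment> \<open>\<open>connected\<close> refers to the symmetric closure; symmetry of the arcs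
    turns it into strong connectivity.\<close>
  have "symmetric (with_proj G)" using assms(2) by (simp add: symmetric_def)
  then have "strongly_connected (with_proj G)"
    using assms(3) by (rule symmetric_connected_imp_strongly_connected)
  then have "u \<rightarrow>\<^sup>*\<^bsub>with_proj G\<^esub> v"
    using assms(4,5) by (simp add: strongly_connected_def)
  then show ?thesis using reachable_rtranclI by fastforce
qed

lemma (in pair_wf_digraph) awalk_imp_relpow:
  "awalk u p v \<Longrightarrow> (u, v) \<in> parcs G ^^ length p"
proof (induction p arbitrary: u)
  case (Cons e p)
  then have "(u, snd e) \<in> parcs G" "(snd e, v) \<in> parcs G ^^ length p"
    by (cases e, auto simp: awalk_Cons_iff)+
  then show ?case by (simp only: list.size add_0_right add_Suc_right relpow_Suc_I2)
qed (simp add: awalk_Nil_iff)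

lemma (in pair_wf_digraph) relpow_imp_awalk:
  "(u, v) \<in> parcs G ^^ n \<Longrightarrow> u \<in> pverts G \<Longrightarrow> \<exists>p. awalk u p v \<and> length p = n"
proof (induction n arbitrary: u)
  case 0
  then show ?case by (auto simp: awalk_Nil_iff)
next
  case (Suc n)
  obtain z where z: "(u, z) \<in> parcs G" "(z, v) \<in> parcs G ^^ n"
    using Suc.prems(1) by (rule relpow_Suc_E2)
  then obtain p where "awalk z p v" "length p = n" using Suc.IH in_arcsD2 by blast
  then show ?case using z(1) by (intro exI[of _ "(u, z) # p"]) (simp add: awalk_Cons_iff)
qed

text \<open>A shortest walk repeats no vertex: otherwise cutting out a cycle would leave a shorter
  walk with the same ends.\<close>

lemma graph_dist_eq_rel_dist:
  assumes "pair_wf_digraph G" "u \<in> pverts G" "(u, v) \<in> (parcs G)\<^sup>*"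
  shows "graph_dist G u v = rel_dist (parcs G) u v"
proof -
  interpret pair_wf_digraph G by fact
  have min: "rel_dist (parcs G) u v \<le> length p" if "awalk u p v" for p
    using awalk_imp_relpow[OF that] by (intro rel_dist_le walk_le_relpow)
  obtain p where p: "awalk u p v" "length p = rel_dist (parcs G) u v"
    using relpow_imp_awalk[OF relpow_rel_dist[OF assms(3)] assms(2)] by blast
  have "apath u p v"
  proof (rule ccontr)
    assume "\<not> apath u p v"
    then have nd: "\<not> distinct (pawalk_verts u p)" using p(1) by (simp add: apath_def)
    obtain q r s where "awalk_cyc_decomp p = (q, r, s)" by (cases "awalk_cyc_decomp p")
    with awalk_cyc_decomp_has_prop[OF p(1) nd] have "is_awalk_cyc_decomp p (q, r, s)" by simp
    then have "length (q @ s) < length p" "awalk u (q @ s) v"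
      using p(1) by (auto dest!: awalk_ends_eqD)
    then show False using min[of "q @ s"] p(2) by simp
  qed
  then show ?thesis
    unfolding graph_dist_def using p(2) min awalkI_apath by (intro Least_equality) auto
qed

lemma distance_matrix_eq_rel_dist:
  assumes "pair_wf_digraph G" "sym (parcs G)" "Digraph_Component.connected (with_proj G)"
    "set vs = pverts G"
  shows "distance_matrix G vs =
    mat (length vs) (length vs) (\<lambda>(i, j). of_nat (rel_dist (parcs G) (vs ! i) (vs ! j)))"
  unfolding distance_matrix_def
proof (rule cong_mat[OF refl refl])
  fix i j assume "i < length vs" "j < length vs"
  then have "vs ! i \<in> pverts G" "vs ! j \<in> pverts G" using assms(4) nth_mem by blast+
  then show "(\<lambda>(r, c). of_nat (graph_dist G (vs ! r) (vs ! c))) (i, j) =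
    (\<lambda>(i, j). of_nat (rel_dist (parcs G) (vs ! i) (vs ! j)) :: complex) (i, j)"
    using graph_dist_eq_rel_dist[OF assms(1)] connected_imp_rtrancl[OF assms(1-3)] by simp
qed

section \<open>Distances in a graph with attached vertices\<close>

text \<open>\<open>H\<close> is a parameter so that the graphs before and after the switching are
  two instances of one relation.\<close>

definition attached_arcs ::
  "'v set \<Rightarrow> ('v \<Rightarrow> nat) \<Rightarrow> 'v rel \<Rightarrow> 'v rel \<Rightarrow> 'v set \<Rightarrow> 'v set \<Rightarrow> ('v \<Rightarrow> 'v set) \<Rightarrow> 'v rel" where
  "attached_arcs A part EA EB F T H = EA \<union> EB \<union>
     sym_arcs {(b, a). a \<in> A \<and> part a = part b \<and> (b \<in> F \<or> b \<in> T \<and> a \<in> H b)}"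

lemma sym_attached_arcs:
  assumes "sym EA" "sym EB" shows "sym (attached_arcs A part EA EB F T H)"
  using assms unfolding attached_arcs_def sym_arcs_def sym_def by auto

definition part_of :: "'v set \<Rightarrow> ('v \<Rightarrow> nat) \<Rightarrow> nat \<Rightarrow> 'v set" where
  "part_of A part i = {a \<in> A. part a = i}"

text \<open>Used with \<open>X = F \<union> T\<close>, the attached vertices that have neighbours in
  their part. Since \<open>H\<close> does not occur, one value serves both graphs.\<close>

definition attach_dist :: "'v rel \<Rightarrow> 'v set \<Rightarrow> 'v \<Rightarrow> nat" where
  "attach_dist EB X b = (LEAST k. \<exists>x\<in>X. (b, x) \<in> EB ^^ k)"

text \<open>
  \<open>A\<close> is the vertex set of the base graph and \<open>V\<close> the set of all attached vertices; \<open>part\<close> maps a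
  vertex of \<open>A\<close> to the index of its part and a vertex of \<open>V\<close> to the index of the part it is attached
  to. The vertices in \<open>F\<close> are joined to their whole part, a vertex \<open>b\<close> in \<open>T\<close> to the half \<open>H b\<close>.
  Switching replaces \<open>H\<close> by its complement and changes nothing else.
\<close>

locale switching =
  fixes A V :: "'v set" and part :: "'v \<Rightarrow> nat" and d :: "nat \<Rightarrow> nat" and EA EB :: "'v rel"
    and F T :: "'v set" and H :: "'v \<Rightarrow> 'v set"
  assumes finite_A: "finite A"
    and disj: "A \<inter> V = {}"
    and EA: "EA \<subseteq> A \<times> A" "sym EA" "irrefl EA"
    and EB: "EB \<subseteq> V \<times> V" "sym EB"
    and EB_part: "(b, b') \<in> EB \<Longrightarrow> part b = part b'"
    and EB_H: "(b, b') \<in> EB \<Longrightarrow> H b = H b'"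
    and module: "(a, a') \<in> EA \<Longrightarrow> part a \<noteq> part a' \<Longrightarrow> a2 \<in> A \<Longrightarrow> part a2 = part a \<Longrightarrow> (a2, a') \<in> EA"
    and degree: "a \<in> A \<Longrightarrow> card {a' \<in> part_of A part (part a). (a, a') \<in> EA} = d (part a)"
    and degree_ge: "a \<in> A \<Longrightarrow> card (part_of A part (part a)) \<le> 2 * d (part a)"
    and half: "b \<in> V \<Longrightarrow> H b \<subseteq> part_of A part (part b)"
      "b \<in> V \<Longrightarrow> 2 * card (H b) = card (part_of A part (part b))"
      "b \<in> V \<Longrightarrow> part_of A part (part b) \<noteq> {}"
    and FT: "F \<subseteq> V" "T \<subseteq> V"
    and connA: "a \<in> A \<Longrightarrow> a' \<in> A \<Longrightarrow> (a, a') \<in> EA\<^sup>*"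
    and conn: "u \<in> A \<union> V \<Longrightarrow> v \<in> A \<union> V \<Longrightarrow> (u, v) \<in> (attached_arcs A part EA EB F T H)\<^sup>*"
begin

abbreviation "P \<equiv> part_of A part"
abbreviation "E \<equiv> attached_arcs A part EA EB F T H"
abbreviation "\<delta> \<equiv> attach_dist EB (F \<union> T)"

section \<open>Neighbourhoods of attached vertices, and walks inside the base graph\<close>

definition nb :: "'v \<Rightarrow> 'v set" where
  "nb b = (if b \<in> F then P (part b) else if b \<in> T then H b else {})"

lemma finite_P: "finite (P i)"
  using finite_A unfolding part_of_def by auto

lemma sym_E: "sym E"
  using EA(2) EB(2) by (rule sym_attached_arcs)

lemma EA_E: "EA \<subseteq> E" and EB_E: "EB \<subseteq> E"
  unfolding attached_arcs_def by auto

lemma nb_sub: "nb b \<subseteq> P (part b)"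
  using half(1) FT unfolding nb_def by auto

lemma nb_A: "a \<in> nb b \<Longrightarrow> a \<in> A" "a \<in> nb b \<Longrightarrow> part a = part b"
  using nb_sub[of b] by (auto simp: part_of_def)

lemma E_A_A: "(a, a') \<in> E \<Longrightarrow> a \<in> A \<Longrightarrow> a' \<in> A \<Longrightarrow> (a, a') \<in> EA"
  using disj EB(1) FT unfolding attached_arcs_def sym_arcs_def by auto

lemma E_V_V: "E \<inter> V \<times> V = EB"
  using disj EA(1) EB(1) FT unfolding attached_arcs_def sym_arcs_def by auto

lemma E_V_A_iff:
  assumes "b \<in> V" "a \<in> A" shows "(b, a) \<in> E \<longleftrightarrow> a \<in> nb b"
proof -
  have "(b, a) \<notin> EA" "(b, a) \<notin> EB" "b \<notin> A"
    using assms disj EA(1) EB(1) by blast+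
  moreover have "a \<in> H b \<Longrightarrow> part a = part b"
    using half(1)[OF assms(1)] by (auto simp: part_of_def)
  ultimately show ?thesis
    using assms(2) unfolding attached_arcs_def sym_arcs_def nb_def part_of_def by auto
qed

lemma nb_E: assumes "a \<in> nb b" shows "(b, a) \<in> E"
proof -
  have "b \<in> V" using assms FT unfolding nb_def by (auto split: if_splits)
  then show ?thesis using E_V_A_iff nb_A assms by auto
qed

lemma E_verts: "(u, v) \<in> E \<Longrightarrow> u \<in> A \<union> V \<and> v \<in> A \<union> V"
  using EA(1) EB(1) FT unfolding attached_arcs_def sym_arcs_def by auto

lemma nb_ne:
  assumes "b \<in> F \<union> T" shows "nb b \<noteq> {}"
proof -
  have "b \<in> V" using assms FT by blast
  then have "P (part b) \<noteq> {}" "2 * card (H b) = card (P (part b))"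
    using half(2,3) by simp_all
  moreover have "H b \<noteq> {}"
    using calculation finite_P[of "part b"] by (metis card.empty card_0_eq mult_0_right)
  ultimately show ?thesis using assms unfolding nb_def by auto
qed

lemma nb_F: "b \<in> F \<Longrightarrow> nb b = P (part b)"
  unfolding nb_def by auto

lemma nb_T: "b \<in> T \<Longrightarrow> b \<notin> F \<Longrightarrow> nb b = H b"
  unfolding nb_def by auto

lemma nb_FT: "a \<in> nb b \<Longrightarrow> b \<in> F \<union> T"
  unfolding nb_def by (auto split: if_splits)

lemma nb_half: "b \<in> F \<union> T \<Longrightarrow> card (P (part b)) \<le> 2 * card (nb b)"
  using half(2)[of b] FT unfolding nb_def by auto

lemma EB_pow: "(b, x) \<in> EB ^^ k \<Longrightarrow> part b = part x \<and> H b = H x"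
proof (induction k arbitrary: x)
  case (Suc k)
  then obtain y where "(b, y) \<in> EB ^^ k" "(y, x) \<in> EB" by auto
  then show ?case using Suc.IH[of y] EB_part[of y x] EB_H[of y x] by simp
qed auto

text \<open>A walk from an attached vertex either stays in \<open>EB\<close> or enters
  \<open>A\<close> through some \<open>nb x\<close>. The prefix up to \<open>x\<close> uses only
  arcs of \<open>EB\<close>, which the switching keeps.\<close>

lemma exit_V:
  assumes "(b, w) \<in> E ^^ n" "b \<in> V" "w \<in> V \<Longrightarrow> (b, w) \<notin> EB ^^ n"
  obtains k x y r where "n = Suc (k + r)" "(b, x) \<in> EB ^^ k" "y \<in> nb x" "(y, w) \<in> E ^^ r"
proof -
  obtain k x y r where *: "n = Suc (k + r)" "(b, x) \<in> (E \<inter> V \<times> V) ^^ k" "x \<in> V"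
    "(x, y) \<in> E" "y \<notin> V" "(y, w) \<in> E ^^ r"
  proof (rule relpow_exit[OF assms(1), of V])
    show "b \<in> V" "w \<in> V \<Longrightarrow> (b, w) \<notin> (E \<inter> V \<times> V) ^^ n"
      using assms(2,3) unfolding E_V_V by auto
  qed
  have "y \<in> A" using E_verts[OF *(4)] *(5) by simp
  then have "y \<in> nb x" using E_V_A_iff[OF *(3)] *(4) by simp
  with * show ?thesis using that unfolding E_V_V by simp
qed

lemma walk_attach:
  assumes "(b, x) \<in> EB ^^ k" "y \<in> nb x"
  shows "walk_le E (Suc k) b y"
proof -
  have "walk_le E k b x" by (rule walk_le_mono_rel[OF walk_le_relpow[OF assms(1)] EB_E])
  moreover have "walk_le E (Suc 0) x y" by (rule walk_le_arc[OF nb_E[OF assms(2)]])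
  ultimately show ?thesis using walk_le_trans by fastforce
qed

text \<open>Pigeonhole: \<open>a\<close> has at least half of its part as neighbours. If none were
  in \<open>S\<close>, they would all lie in the part without \<open>S\<close> and without
  \<open>a\<close> itself, which is strictly less than half.\<close>

lemma adjacent_to_half:
  assumes "a \<in> A" "S \<subseteq> P (part a)" "card (P (part a)) \<le> 2 * card S" "a \<notin> S"
  shows "\<exists>s\<in>S. (a, s) \<in> EA"
proof (rule ccontr)
  assume contra: "\<not> ?thesis"
  let ?N = "{a' \<in> P (part a). (a, a') \<in> EA}"
  have "?N \<subseteq> P (part a) - S - {a}"
    using contra EA(3) by (auto simp: irrefl_def)
  then have "card ?N \<le> card (P (part a) - S - {a})"
    using finite_P by (intro card_mono) auto
  also have "\<dots> < card (P (part a) - S)"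
    using finite_P assms(1,4) by (intro psubset_card_mono) (auto simp: part_of_def)
  also have "\<dots> = card (P (part a)) - card S"
    using assms(2) finite_P by (meson card_Diff_subset finite_subset)
  finally show False
    using degree[OF assms(1)] degree_ge[OF assms(1)] assms(3) by linarith
qed

text \<open>Here \<open>adjacent_to_half\<close> is applied to the neighbourhood of
  \<open>a'\<close>, which fills at least half of the part: \<open>a\<close> either belongs to it or
  has a neighbour in it.\<close>

lemma walk_part:
  assumes "a \<in> A" "a' \<in> A" "part a = part a'"
  shows "walk_le EA 2 a a'"
proof (cases "a = a'")
  case True
  then show ?thesis by (simp add: walk_le_refl)
next
  case False
  let ?N = "{x \<in> P (part a'). (a', x) \<in> EA}"
  show ?thesis
  proof (cases "a \<in> ?N")
    case True
    then have "(a, a') \<in> EA" using EA(2) by (auto dest: symD)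
    then show ?thesis using walk_le_arc[of a a' EA 1] by (simp add: numeral_2_eq_2)
  next
    case False
    then obtain s where "s \<in> ?N" "(a, s) \<in> EA"
      using adjacent_to_half[of a ?N] assms degree[of a'] degree_ge[of a'] by auto
    then have "walk_le EA (Suc 0) a s" "walk_le EA (Suc 0) s a'"
      using EA(2) by (auto intro: walk_le_arc dest: symD)
    then show ?thesis using walk_le_trans by (fastforce simp: numeral_2_eq_2)
  qed
qed

text \<open>The first arc leaving the part of \<open>u\<close> ends at a vertex \<open>y\<close>
  adjacent to the whole part, so \<open>u'\<close> can step to \<open>y\<close> at once. The
  \<open>k\<close> arcs inside the part are dropped.\<close>

lemma walk_other_part_left:
  assumes "(u, w) \<in> EA ^^ n" "u \<in> A" "u' \<in> A" "part u = part u'" "part w \<noteq> part u"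
  shows "walk_le EA n u' w"
proof -
  obtain k x y r where *: "n = Suc (k + r)" "(u, x) \<in> (EA \<inter> P (part u) \<times> P (part u)) ^^ k"
    "x \<in> P (part u)" "(x, y) \<in> EA" "y \<notin> P (part u)" "(y, w) \<in> EA ^^ r"
  proof (rule relpow_exit[OF assms(1), of "P (part u)"])
    show "u \<in> P (part u)"
      "w \<in> P (part u) \<Longrightarrow> (u, w) \<notin> (EA \<inter> P (part u) \<times> P (part u)) ^^ n" using assms by (auto simp: part_of_def)
  qed
  have "y \<in> A" using *(4) EA(1) by blast
  then have "part x \<noteq> part y" "part u' = part x"
    using *(3,5) assms(4) by (simp_all add: part_of_def)
  then have "(u', y) \<in> EA" using module *(4) assms(3) by blast
  then have "walk_le EA (Suc 0 + r) u' w"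
    by (intro walk_le_trans[OF walk_le_arc walk_le_relpow[OF *(6)]])
  then show ?thesis by (rule walk_le_mono) (simp add: *(1))
qed

lemma walk_other_part:
  assumes "walk_le EA n u w" "u \<in> A" "u' \<in> A" "w \<in> A" "w' \<in> A"
    "part u = part u'" "part w = part w'" "part w \<noteq> part u"
  shows "walk_le EA n u' w'"
proof -
  have left: "walk_le EA n a' c" if le: "walk_le EA n a c" and ac: "a \<in> A" "a' \<in> A" "part a = part a'"
      "part c \<noteq> part a" for a a' c
  proof -
    obtain k where "k \<le> n" "(a, c) \<in> EA ^^ k" using le unfolding walk_le_def by blast
    then show ?thesis using walk_le_mono[OF walk_other_part_left[OF _ ac]] by simp
  qed
  have "walk_le EA n u' w" using left[OF assms(1-3,6,8)] .
  then have "walk_le EA n w u'" by (rule walk_le_sym[OF EA(2)])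
  then have "walk_le EA n w' u'" using left assms(4-8) by simp
  then show ?thesis by (rule walk_le_sym[OF EA(2)])
qed

text \<open>A detour through attached vertices leaves \<open>A\<close> at \<open>u\<close>, returns
  at some \<open>y\<close> in the same part, and costs at least two arcs; \<open>walk_part\<close>
  replaces it by at most two arcs of \<open>A\<close>. The rest of the walk is shorter by
  \<open>k + 2\<close>, hence the strong induction.\<close>

lemma walk_in_A:
  assumes "(u, w) \<in> E ^^ n" "u \<in> A" "w \<in> A"
  shows "walk_le EA n u w"
  using assms(1,2)
proof (induction n arbitrary: u rule: less_induct)
  case (less n)
  show ?case
  proof (cases n)
    case 0
    then show ?thesis using less.prems by (auto intro: walk_le_refl)
  next
    case (Suc n')
    then obtain z where z: "(u, z) \<in> E" "(z, w) \<in> E ^^ n'"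
      using less.prems(1) by (blast elim: relpow_Suc_E2)
    show ?thesis
    proof (cases "z \<in> A")
      case True
      then have "walk_le EA (Suc 0) u z" "walk_le EA n' z w"
        using E_A_A z less.prems(2) less.IH[of n' z] Suc by (auto intro: walk_le_arc)
      then show ?thesis using walk_le_trans Suc by fastforce
    next
      case False
      then have zV: "z \<in> V" using E_verts z by blast
      obtain k x y r where *: "n' = Suc (k + r)" "(z, x) \<in> EB ^^ k" "y \<in> nb x" "(y, w) \<in> E ^^ r"
        by (rule exit_V[OF z(2) zV]) (use assms(3) disj in auto)
      have "u \<in> nb z" using z(1) sym_E E_V_A_iff zV less.prems(2) by (blast dest: symD)
      then have "part u = part y" "y \<in> A"
        using nb_A * EB_pow by metis+
      then have "walk_le EA 2 u y" "walk_le EA r y w"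
        using walk_part less.prems(2) less.IH[of r y] * Suc by auto
      then show ?thesis using walk_le_trans[of EA 2 u y r w] walk_le_mono Suc * by fastforce
    qed
  qed
qed

section \<open>Exact distances between base vertices, and from an attached vertex to its
  part\<close>

lemma dist_A_A:
  assumes "u \<in> A" "w \<in> A" shows "rel_dist E u w = rel_dist EA u w"
proof (rule antisym)
  show "rel_dist E u w \<le> rel_dist EA u w"
    by (intro rel_dist_le walk_le_mono_rel[OF walk_le_relpow EA_E] relpow_rel_dist connA assms)
  show "rel_dist EA u w \<le> rel_dist E u w"
    by (intro rel_dist_le walk_in_A relpow_rel_dist conn) (use assms in auto)
qed

lemma dist_part:
  assumes "u \<in> A" "w \<in> A" "part u = part w"
  shows "rel_dist EA u w = (if u = w then 0 else if (u, w) \<in> EA then 1 else 2)"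
proof -
  have le: "rel_dist EA u w \<le> 2" by (intro rel_dist_le walk_part assms)
  have pow: "(u, w) \<in> EA ^^ rel_dist EA u w"
    using relpow_rel_dist[OF connA[OF assms(1,2)]] .
  have 0: "rel_dist EA u w = 0 \<longleftrightarrow> u = w"
  proof
    assume "rel_dist EA u w = 0"
    then show "u = w" using pow by simp
  next
    assume "u = w"
    then show "rel_dist EA u w = 0" using rel_dist_le[OF walk_le_refl[of EA 0 u]] by simp
  qed
  have 1: "rel_dist EA u w = 1 \<longleftrightarrow> (u, w) \<in> EA"
  proof
    assume "rel_dist EA u w = 1"
    then show "(u, w) \<in> EA" using pow by simp
  next
    assume uw: "(u, w) \<in> EA"
    then have "u \<noteq> w" using EA(3) by (auto simp: irrefl_def)
    then show "rel_dist EA u w = 1" using 0 rel_dist_le[OF walk_le_arc[OF uw, of 0]] by simp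
  qed
  show ?thesis using le 0 1 by (auto simp: less_Suc_eq numeral_2_eq_2 le_Suc_eq)
qed

text \<open>Adding one for each neighbour of \<open>u\<close> and two for \<open>u\<close> itself
  raises every distance in the part to two. The additive form avoids subtraction on
  naturals.\<close>

lemma dist_part_sum:
  assumes "u \<in> A"
  shows "(\<Sum>w\<in>P (part u). rel_dist EA u w) + d (part u) + 2 = 2 * card (P (part u))"
proof -
  have uP: "u \<in> P (part u)" using assms by (auto simp: part_of_def)
  have "(\<Sum>w\<in>P (part u). rel_dist EA u w + (if (u, w) \<in> EA then 1 else 0) + (if u = w then 2 else 0))
      = (\<Sum>w\<in>P (part u). 2)"
    using dist_part[OF assms] EA(3) by (intro sum.cong) (auto simp: part_of_def irrefl_def)
  moreover have "(\<Sum>w\<in>P (part u). if (u, w) \<in> EA then 1 else 0) = d (part u)"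
    using degree[OF assms] finite_P by (simp add: sum.If_cases Int_def)
  moreover have "(\<Sum>w\<in>P (part u). if u = w then 2 else 0) = (2::nat)"
    using uP finite_P by simp
  ultimately show ?thesis by (simp add: sum.distrib)
qed

lemma dist_parts_const:
  assumes "u \<in> A" "u' \<in> A" "w \<in> A" "w' \<in> A" "part u = part u'" "part w = part w'" "part w \<noteq> part u"
  shows "rel_dist EA u w = rel_dist EA u' w'"
proof (rule antisym)
  show "rel_dist EA u' w' \<le> rel_dist EA u w"
    using assms walk_other_part[of _ u w u' w'] relpow_rel_dist[OF connA] walk_le_relpow rel_dist_le
    by metis
  show "rel_dist EA u w \<le> rel_dist EA u' w'"
    using assms walk_other_part[of _ u' w' u w] relpow_rel_dist[OF connA] walk_le_relpow rel_dist_le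
    by metis
qed

text \<open>Connectivity gives a walk from \<open>b\<close> into \<open>A\<close>, and its exit from
  \<open>V\<close> provides a vertex of \<open>F \<union> T\<close> reachable in \<open>EB\<close>;
  hence the minimum in \<open>\<delta>\<close> exists.\<close>

lemma attach_dist_attained:
  assumes "b \<in> V" shows "\<exists>x \<in> F \<union> T. (b, x) \<in> EB ^^ \<delta> b"
proof -
  obtain a where a: "a \<in> A" using half(3)[OF assms] by (auto simp: part_of_def)
  then obtain n where "(b, a) \<in> E ^^ n" using conn[of b a] assms rtrancl_imp_relpow by blast
  then obtain k x y where "(b, x) \<in> EB ^^ k" "y \<in> nb x"
    by (rule exit_V[OF _ assms]) (use a disj in auto)
  then have "(b, x) \<in> EB ^^ k" "x \<in> F \<union> T" using nb_FT by simp_all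
  then have "\<exists>k. \<exists>x\<in>F \<union> T. (b, x) \<in> EB ^^ k" by blast
  then show ?thesis unfolding attach_dist_def by (rule LeastI_ex)
qed

text \<open>Every walk to \<open>a\<close> first spends at least \<open>\<delta> b\<close> arcs in
  \<open>EB\<close> and one arc to enter the part. That suffices if a nearest entry vertex is fully
  joined or if \<open>a\<close> lies in \<open>H b\<close>; otherwise one more arc does, since
  \<open>a\<close> then has a neighbour in \<open>H b\<close>.\<close>

lemma dist_attached:
  assumes "b \<in> V" "a \<in> P (part b)"
  shows "rel_dist E b a =
    (if (\<exists>x\<in>F. (b, x) \<in> EB ^^ \<delta> b) \<or> a \<in> H b then Suc (\<delta> b) else Suc (Suc (\<delta> b)))"
    (is "_ = (if ?Q then _ else _)")
proof -
  have aA: "a \<in> A" "part a = part b" using assms(2) by (auto simp: part_of_def)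
  obtain k x y r where *: "rel_dist E b a = Suc (k + r)" "(b, x) \<in> EB ^^ k" "y \<in> nb x"
      "(y, a) \<in> E ^^ r"
    by (rule exit_V[OF relpow_rel_dist[OF conn] assms(1)]) (use assms(1) aA(1) disj in auto)
  have dk: "\<delta> b \<le> k"
    unfolding attach_dist_def using * nb_FT by (intro Least_le) blast
  obtain x0 where x0: "x0 \<in> F \<union> T" "(b, x0) \<in> EB ^^ \<delta> b"
    using attach_dist_attained[OF assms(1)] by blast
  have x0p: "part x0 = part b" "H x0 = H b" using EB_pow[OF x0(2)] by auto
  show ?thesis
  proof (cases ?Q)
    case True
    have "walk_le E (Suc (\<delta> b)) b a"
    proof (cases "\<exists>x\<in>F. (b, x) \<in> EB ^^ \<delta> b")
      case True
      then show ?thesis using walk_attach nb_F EB_pow assms(2) by metis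
    next
      case False
      then have "a \<in> nb x0" using \<open>?Q\<close> x0 x0p nb_T by auto
      then show ?thesis using walk_attach[OF x0(2)] by simp
    qed
    then have "rel_dist E b a \<le> Suc (\<delta> b)" by (rule rel_dist_le)
    then show ?thesis using *(1) dk True by simp
  next
    case False
    then have "nb x0 = H b" using x0 x0p nb_T by auto
    then obtain s where s: "s \<in> nb x0" "(a, s) \<in> EA"
      using adjacent_to_half[of a "H b"] aA half[OF assms(1)] False by auto
    then have "walk_le E (Suc 0) s a" using EA(2) EA_E walk_le_arc by (metis subsetD symD)
    with walk_attach[OF x0(2) s(1)] have "walk_le E (Suc (\<delta> b) + Suc 0) b a" by (rule walk_le_trans)
    then have ub: "rel_dist E b a \<le> Suc (Suc (\<delta> b))" using rel_dist_le by fastforce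
    \<comment> \<open>A walk this short enters \<open>A\<close> directly at \<open>a\<close> from a
      nearest entry vertex, which then lies in \<open>F\<close> or has \<open>a\<close> in its half;
      the present case excludes both.\<close>
    have "rel_dist E b a \<noteq> Suc (\<delta> b)"
    proof
      assume "rel_dist E b a = Suc (\<delta> b)"
      then have "k = \<delta> b" "r = 0" using * dk by auto
      then have "a \<in> nb x" "(b, x) \<in> EB ^^ \<delta> b" using * by auto
      then show False
        using False nb_FT[of a x] nb_T[of x] EB_pow[of b x] by auto
    qed
    then show ?thesis using ub *(1) dk False by simp
  qed
qed

end

section \<open>Comparison with the switched graph\<close>

locale switching_pair =
  S: switching A V part d EA EB F T H + S': switching A V part d EA EB F T H'
  for A V :: "'v set" and part d EA EB F T H H' +
  assumes complement: "b \<in> V \<Longrightarrow> H' b = part_of A part (part b) - H b"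
begin

abbreviation "P \<equiv> part_of A part"
abbreviation "D u v \<equiv> rel_dist (attached_arcs A part EA EB F T H) u v"
abbreviation "D' u v \<equiv> rel_dist (attached_arcs A part EA EB F T H') u v"

text \<open>By this symmetry each inequality between the two distances yields equality.\<close>

lemma switching_pair_swap: "switching_pair A V part d EA EB F T H' H"
proof
  fix b assume "b \<in> V"
  then show "H b = P (part b) - H' b" using complement S.half(1) by auto
qed

text \<open>Two halves of one part have sizes adding up to the whole, so they meet exactly when
  their union misses a vertex, that is, when their complements meet. A full neighbourhood meets
  every nonempty one in its part.\<close>

lemma nb_inter:
  assumes "part x = part x'" "S.nb x \<inter> S.nb x' \<noteq> {}"
  shows "S'.nb x \<inter> S'.nb x' \<noteq> {}"
proof -
  have x: "x \<in> F \<union> T" "x' \<in> F \<union> T" using assms(2) S.nb_FT by blast+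
  then have ne: "S'.nb x \<noteq> {}" "S'.nb x' \<noteq> {}" using S'.nb_ne by blast+
  consider "x \<in> F" | "x' \<in> F" | "x \<in> T - F" "x' \<in> T - F" using x by blast
  then show ?thesis
  proof cases
    case 1
    then show ?thesis using S'.nb_F[of x] S'.nb_sub[of x'] assms(1) ne by auto
  next
    case 2
    then show ?thesis using S'.nb_F[of x'] S'.nb_sub[of x] assms(1) ne by auto
  next
    case 3
    then have V: "x \<in> V" "x' \<in> V" using S.FT by blast+
    let ?P = "P (part x)"
    have nb: "S.nb x = H x" "S.nb x' = H x'" "S'.nb x = ?P - H x" "S'.nb x' = ?P - H x'"
      using 3 S.nb_T S'.nb_T complement V assms(1) by auto
    have half: "H x \<subseteq> ?P" "H x' \<subseteq> ?P" "2 * card (H x) = card ?P" "2 * card (H x') = card ?P"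
      using S.half[OF V(1)] S.half[OF V(2)] assms(1) by auto
    have fin: "finite (H x)" "finite (H x')" using half S.finite_P finite_subset by metis+
    have "card (H x \<inter> H x') > 0" using assms(2) nb fin by (auto simp: card_gt_0_iff)
    then have "card (H x \<union> H x') < card ?P"
      using card_Un_Int[OF fin] half by linarith
    then have "H x \<union> H x' \<noteq> ?P" by auto
    then show ?thesis using half nb by blast
  qed
qed

text \<open>Moves a walk between two old neighbourhoods to the new ones without lengthening it. For
  different parts the ends may be moved freely; for the same part, length zero or one is
  enough.\<close>

lemma nb_walk:
  assumes "y \<in> S.nb x" "y' \<in> S.nb x'" "walk_le EA r y y'"
  shows "\<exists>z\<in>S'.nb x. \<exists>z'\<in>S'.nb x'. walk_le EA r z z'"
proof -
  have x: "x \<in> F \<union> T" "x' \<in> F \<union> T" using assms S.nb_FT by blast+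
  then obtain z z' where z: "z \<in> S'.nb x" "z' \<in> S'.nb x'" using S'.nb_ne by blast
  have parts: "y \<in> A" "y' \<in> A" "z \<in> A" "z' \<in> A" "part y = part x" "part y' = part x'"
    "part z = part x" "part z' = part x'"
    using assms z S.nb_A S'.nb_A by auto
  show ?thesis
  proof (cases "part x = part x'")
    case False
    then have "walk_le EA r z z'" using S.walk_other_part[OF assms(3)] parts by simp
    then show ?thesis using z by blast
  next
    case True
    show ?thesis
    proof (cases "S'.nb x \<inter> S'.nb x' = {}")
      case False
      then obtain s where "s \<in> S'.nb x" "s \<in> S'.nb x'" by blast
      then show ?thesis using walk_le_refl by (intro bexI[of _ s])
    next
      case disjoint: True
      \<comment> \<open>If the new neighbourhoods are disjoint, so were the old ones; thus the given
        walk has length at least one, and a single arc from \<open>z'\<close> into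
        \<open>S'.nb x\<close> fits the bound.\<close>
      then have "y \<noteq> y'" using nb_inter[OF True] assms(1,2) by blast
      then have "r \<noteq> 0" using assms(3) unfolding walk_le_def by (intro notI) auto
      then obtain r' where r': "r = Suc r'" using not0_implies_Suc by blast
      have "z' \<notin> S'.nb x" using disjoint z by blast
      then obtain s where s: "s \<in> S'.nb x" "(z', s) \<in> EA"
        using S.adjacent_to_half[of z' "S'.nb x"] S'.nb_sub[of x] S'.nb_half[OF x(1)] parts True
        by auto
      then have "walk_le EA r s z'" using r' S.EA(2) walk_le_arc by (metis symD)
      then show ?thesis using s z by blast
    qed
  qed
qed

text \<open>Unless the walk can be taken in \<open>EB\<close>, it is cut at both ends. The outer
  pieces lie in \<open>EB\<close> and survive; the middle piece joins base vertices, so it can be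
  taken inside \<open>A\<close> and moved by \<open>nb_walk\<close>.\<close>

lemma walk_V_V:
  assumes "(b, b') \<in> S.E ^^ n" "b \<in> V" "b' \<in> V"
  shows "walk_le S'.E n b b'"
proof (cases "(b, b') \<in> EB ^^ n")
  case True
  then show ?thesis by (intro walk_le_mono_rel[OF walk_le_relpow S'.EB_E])
next
  case False
  obtain k x y r where 1: "n = Suc (k + r)" "(b, x) \<in> EB ^^ k" "y \<in> S.nb x" "(y, b') \<in> S.E ^^ r"
    by (rule S.exit_V[OF assms(1,2)]) (use False in auto)
  have y: "y \<in> A" using 1(3) S.nb_A by blast
  \<comment> \<open>The remainder is reversed, so the first exit seen from \<open>b'\<close> is the
    last entry of the original walk into \<open>V\<close>.\<close>
  obtain k' x' y' r' where 2: "r = Suc (k' + r')" "(b', x') \<in> EB ^^ k'" "y' \<in> S.nb x'"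
    "(y', y) \<in> S.E ^^ r'"
    by (rule S.exit_V[OF relpow_sym[OF S.sym_E 1(4)] assms(3)]) (use S.disj y in auto)
  have "walk_le EA r' y' y" using S.walk_in_A[OF 2(4)] y S.nb_A 2(3) by simp
  then obtain z z' where z: "z \<in> S'.nb x" "z' \<in> S'.nb x'" "walk_le EA r' z z'"
    using nb_walk[OF 1(3) 2(3)] walk_le_sym[OF S.EA(2)] by blast
  have "walk_le S'.E (Suc k) b z" using S'.walk_attach[OF 1(2) z(1)] .
  moreover have "walk_le S'.E r' z z'" using z(3) S'.EA_E walk_le_mono_rel by metis
  moreover have "walk_le S'.E (Suc k') z' b'"
    using S'.walk_attach[OF 2(2) z(2)] walk_le_sym[OF S'.sym_E] by simp
  ultimately have "walk_le S'.E (Suc k + r' + Suc k') b b'" by (intro walk_le_trans)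
  then show ?thesis by (rule walk_le_mono) (use 1(1) 2(1) in simp)
qed

text \<open>The inner walk joins different parts, so both its start in \<open>nb x\<close> and its
  end can be moved. The free choice of \<open>a'\<close> also gives constancy of the distance over
  the part.\<close>

lemma walk_V_A:
  assumes "(b, a) \<in> S.E ^^ n" "b \<in> V" "a \<in> A" "a' \<in> A" "part a = part a'" "part a \<noteq> part b"
  shows "walk_le S'.E n b a'"
proof -
  obtain k x y r where 1: "n = Suc (k + r)" "(b, x) \<in> EB ^^ k" "y \<in> S.nb x" "(y, a) \<in> S.E ^^ r"
    by (rule S.exit_V[OF assms(1,2)]) (use S.disj assms(3) in auto)
  have x: "part x = part b" "x \<in> F \<union> T" using S.EB_pow[OF 1(2)] S.nb_FT[OF 1(3)] by auto
  then obtain z where z: "z \<in> S'.nb x" using S'.nb_ne by blast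
  have "walk_le EA r y a" using S.walk_in_A[OF 1(4)] S.nb_A 1(3) assms(3) by simp
  then have "walk_le EA r z a'"
    using S.walk_other_part[of r y a z a'] S.nb_A[OF 1(3)] S'.nb_A[OF z] assms x by simp
  then have "walk_le S'.E r z a'" by (rule walk_le_mono_rel[OF _ S'.EA_E])
  then have "walk_le S'.E (Suc k + r) b a'" using S'.walk_attach[OF 1(2) z] by (intro walk_le_trans)
  then show ?thesis using 1(1) by simp
qed

lemma dist_V_V_le:
  assumes "b \<in> V" "b' \<in> V" shows "D' b b' \<le> D b b'"
  by (intro rel_dist_le walk_V_V relpow_rel_dist S.conn) (use assms in auto)

lemma dist_V_A_le:
  assumes "b \<in> V" "a \<in> A" "a' \<in> A" "part a = part a'" "part a \<noteq> part b"
  shows "D' b a' \<le> D b a"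
  by (rule rel_dist_le, rule walk_V_A[where a = a], rule relpow_rel_dist, rule S.conn) (use assms in auto)

lemma dist_V_V:
  assumes "b \<in> V" "b' \<in> V" shows "D' b b' = D b b'"
  by (rule antisym[OF dist_V_V_le[OF assms] switching_pair.dist_V_V_le[OF switching_pair_swap assms]])

lemma dist_V_A:
  assumes "b \<in> V" "a \<in> A" "a' \<in> A" "part a = part a'" "part a \<noteq> part b"
  shows "D' b a' = D b a"
  by (rule antisym[OF dist_V_A_le[OF assms] switching_pair.dist_V_A_le[OF switching_pair_swap]])
    (use assms in auto)

text \<open>On its own part, the distances from an attached vertex are either constant or take two
  consecutive values on complementary halves, which the switching exchanges.\<close>

lemma dist_V_part:
  assumes "b \<in> V" "a \<in> P (part b)"
  shows "2 * (\<Sum>v\<in>P (part b). D b v) = card (P (part b)) * (D b a + D' b a)"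
proof -
  let ?\<delta> = "attach_dist EB (F \<union> T) b" and ?Q = "\<exists>x\<in>F. (b, x) \<in> EB ^^ attach_dist EB (F \<union> T) b"
  have D: "D b v = (if ?Q \<or> v \<in> H b then Suc ?\<delta> else Suc (Suc ?\<delta>))" if "v \<in> P (part b)" for v
    using S.dist_attached[OF assms(1) that] .
  have D': "D' b v = (if ?Q \<or> v \<notin> H b then Suc ?\<delta> else Suc (Suc ?\<delta>))" if "v \<in> P (part b)" for v
    using S'.dist_attached[OF assms(1) that] complement[OF assms(1)] that by simp
  show ?thesis
  proof (cases ?Q)
    case True
    then show ?thesis using D D' assms(2) by simp
  next
    case False
    have H: "P (part b) \<inter> {v. v \<in> H b} = H b" "P (part b) \<inter> - {v. v \<in> H b} = P (part b) - H b"
      using S.half(1)[OF assms(1)] by auto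
    have fin: "finite (H b)" using S.half(1)[OF assms(1)] S.finite_P finite_subset by metis
    have c: "card (P (part b)) = 2 * card (H b)" "card (P (part b) - H b) = card (H b)"
      using S.half[OF assms(1)] fin by (auto simp: card_Diff_subset)
    have "(\<Sum>v\<in>P (part b). D b v) = (\<Sum>v\<in>P (part b). if v \<in> H b then Suc ?\<delta> else Suc (Suc ?\<delta>))"
      using D False by (intro sum.cong) auto
    also have "\<dots> = card (H b) * Suc ?\<delta> + card (H b) * Suc (Suc ?\<delta>)"
      using S.finite_P H c by (simp add: sum.If_cases)
    finally have sum: "(\<Sum>v\<in>P (part b). D b v) = card (H b) * (2 * ?\<delta> + 3)"
      by (simp add: algebra_simps)
    \<comment> \<open>Whichever half contains \<open>a\<close>, one distance is
      \<open>?\<delta> + 1\<close> and the other \<open>?\<delta> + 2\<close>.\<close>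
    have "D b a + D' b a = 2 * ?\<delta> + 3" using D[OF assms(2)] D'[OF assms(2)] False by auto
    then show ?thesis unfolding sum c(1) by simp
  qed
qed

end

text \<open>The conditions on \<open>H\<close> pass to complements within the parts, except
  connectivity of the resulting graph, which has to be supplied.\<close>

lemma (in switching) switching_pair_complement:
  defines "H' \<equiv> \<lambda>b. P (part b) - H b"
  assumes conn': "\<And>u v. u \<in> A \<union> V \<Longrightarrow> v \<in> A \<union> V \<Longrightarrow>
    (u, v) \<in> (attached_arcs A part EA EB F T H')\<^sup>*"
  shows "switching_pair A V part d EA EB F T H H'"
proof -
  interpret S': switching A V part d EA EB F T H'
  proof
    show "H' b = H' b'" if "(b, b') \<in> EB" for b b'
      using EB_part[OF that] EB_H[OF that] by (simp add: H'_def)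
    show "2 * card (H' b) = card (P (part b))" if "b \<in> V" for b
    proof -
      have "finite (H b)" using half(1)[OF that] finite_P by (rule finite_subset)
      then show ?thesis
        using half(1,2)[OF that] by (simp add: H'_def card_Diff_subset)
    qed
    show "H' b \<subseteq> P (part b)" for b by (auto simp: H'_def)
    show "part_of A part (part b) \<noteq> {}" if "b \<in> V" for b using half(3)[OF that] .
  qed (fact finite_A disj EA EB EB_part module degree degree_ge FT connA conn')+
  show ?thesis by unfold_locales (simp add: H'_def)
qed

section \<open>The intertwining matrix\<close>

lemma sum_nth_eq_sum_set:
  assumes "distinct xs"
  shows "(\<Sum>i = 0..<length xs. f (xs ! i)) = (\<Sum>x\<in>set xs. f x)"
  unfolding atLeast0LessThan by (rule sum.reindex_bij_betw[OF bij_betw_nth[OF assms refl refl]])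

text \<open>The rows of the transformation matrix are ordered by one enumeration and its columns by the
  other, so that no separate permutation matrix is needed.\<close>

lemma char_poly_eq_if_intertwined:
  fixes q D D' :: "'v \<Rightarrow> 'v \<Rightarrow> 'a :: field"
  assumes vs: "distinct vs" "set vs = W" and ws: "distinct ws" "set ws = W"
    and orth: "\<And>u w. u \<in> W \<Longrightarrow> w \<in> W \<Longrightarrow> (\<Sum>v\<in>W. q u v * q w v) = (if u = w then 1 else 0)"
    and comm: "\<And>u w. u \<in> W \<Longrightarrow> w \<in> W \<Longrightarrow> (\<Sum>v\<in>W. q u v * D' v w) = (\<Sum>v\<in>W. D u v * q v w)"
  shows "char_poly (mat (length vs) (length vs) (\<lambda>(i, j). D (vs ! i) (vs ! j))) =
    char_poly (mat (length ws) (length ws) (\<lambda>(i, j). D' (ws ! i) (ws ! j)))"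
    (is "char_poly ?M = char_poly ?M'")
proof -
  define n where "n = length vs"
  have len: "length vs = n" "length ws = n"
    using vs ws distinct_card[of vs] distinct_card[of ws] n_def by auto
  have in_W: "vs ! i \<in> W" "ws ! i \<in> W" if "i < n" for i
    using that vs(2) ws(2) len nth_mem by metis+
  have sum_vs: "(\<Sum>i = 0..<n. f (vs ! i)) = (\<Sum>v\<in>W. f v)"
    and sum_ws: "(\<Sum>i = 0..<n. f (ws ! i)) = (\<Sum>v\<in>W. f v)" for f :: "'v \<Rightarrow> 'a"
    using sum_nth_eq_sum_set[OF vs(1), of f] sum_nth_eq_sum_set[OF ws(1), of f]
    unfolding len vs(2) ws(2) .
  define Q where "Q = mat n n (\<lambda>(i, j). q (vs ! i) (ws ! j))"
  \<comment> \<open>\<open>R\<close> is the transpose of \<open>Q\<close>. By \<open>orth\<close> it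
    is a right inverse, hence a two-sided one because the matrices are square.\<close>
  define R where "R = mat n n (\<lambda>(i, j). q (vs ! j) (ws ! i))"
  have carrier: "?M \<in> carrier_mat n n" "?M' \<in> carrier_mat n n" "Q \<in> carrier_mat n n"
    "R \<in> carrier_mat n n"
    unfolding Q_def R_def len by auto
  have QR: "Q * R = 1\<^sub>m n"
  proof (rule eq_matI)
    fix i j assume "i < dim_row (1\<^sub>m n)" "j < dim_col (1\<^sub>m n)"
    then have ij: "i < n" "j < n" by auto
    have "(Q * R) $$ (i, j) = (\<Sum>k = 0..<n. q (vs ! i) (ws ! k) * q (vs ! j) (ws ! k))"
      using ij unfolding Q_def R_def by (simp add: scalar_prod_def)
    also have "\<dots> = (if vs ! i = vs ! j then 1 else 0)"
      using sum_ws[of "\<lambda>v. q (vs ! i) v * q (vs ! j) v"] orth in_W ij by simp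
    also have "\<dots> = 1\<^sub>m n $$ (i, j)"
      using ij vs(1) len by (simp add: nth_eq_iff_index_eq)
    finally show "(Q * R) $$ (i, j) = 1\<^sub>m n $$ (i, j)" .
  qed (use carrier in auto)
  then have RQ: "R * Q = 1\<^sub>m n"
    by (rule mat_mult_left_right_inverse[OF carrier(3,4)])
  have comm': "Q * ?M' = ?M * Q"
  proof (rule eq_matI)
    fix i j assume "i < dim_row (?M * Q)" "j < dim_col (?M * Q)"
    then have ij: "i < n" "j < n" using carrier by auto
    have "(Q * ?M') $$ (i, j) = (\<Sum>k = 0..<n. q (vs ! i) (ws ! k) * D' (ws ! k) (ws ! j))"
      using ij unfolding Q_def len by (simp add: scalar_prod_def)
    also have "\<dots> = (\<Sum>k = 0..<n. D (vs ! i) (vs ! k) * q (vs ! k) (ws ! j))"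
      using sum_ws[of "\<lambda>v. q (vs ! i) v * D' v (ws ! j)"]
        sum_vs[of "\<lambda>v. D (vs ! i) v * q v (ws ! j)"] comm in_W ij by simp
    also have "\<dots> = (?M * Q) $$ (i, j)"
      using ij unfolding Q_def len by (simp add: scalar_prod_def)
    finally show "(Q * ?M') $$ (i, j) = (?M * Q) $$ (i, j)" .
  qed (use carrier in auto)
  have "?M = ?M * (Q * R)" unfolding QR using right_mult_one_mat[OF carrier(1)] by simp
  also have "\<dots> = Q * ?M' * R" unfolding comm' by (rule assoc_mult_mat[OF carrier(1,3,4), symmetric])
  finally have "similar_mat ?M ?M'" using carrier QR RQ by (intro similar_matI[of _ _ Q R n]) auto
  then show ?thesis by (rule char_poly_similar)
qed

section \<open>The block reflection and the intertwining identity\<close>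

context switching_pair
begin

text \<open>The entries of the block diagonal matrix with blocks \<open>(2/n) J - I\<close> on the parts of size \<open>n\<close>
  and the identity on the attached vertices.\<close>

definition q :: "'v \<Rightarrow> 'v \<Rightarrow> complex" where
  "q u v = (if u \<in> A \<and> v \<in> A \<and> part u = part v then 2 / of_nat (card (P (part u))) else 0)
     + (if u = v then (if u \<in> A then - 1 else 1) else 0)"

lemma q_sym: "q u v = q v u"
  unfolding q_def by (cases "u = v") simp_all

text \<open>The action of \<open>q\<close> on a function: twice the mean over the part minus the
  value on \<open>A\<close>, and no change on \<open>V\<close>. All later sums are evaluated through
  it.\<close>

lemma sum_q:
  assumes "finite V" "u \<in> A \<union> V"
  shows "(\<Sum>v\<in>A \<union> V. q u v * f v) =
    (if u \<in> A then 2 / of_nat (card (P (part u))) * (\<Sum>v\<in>P (part u). f v) - f u else f u)"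
proof -
  have fin: "finite (A \<union> V)" using assms S.finite_A by simp
  have "q u v * f v =
      (if u \<in> A \<and> v \<in> A \<and> part u = part v then 2 / of_nat (card (P (part u))) * f v else 0)
      + (if u = v then (if u \<in> A then - 1 else 1) * f v else 0)" for v
    unfolding q_def by (auto simp: algebra_simps)
  then have "(\<Sum>v\<in>A \<union> V. q u v * f v) =
      (\<Sum>v\<in>A \<union> V. if u \<in> A \<and> v \<in> A \<and> part u = part v then 2 / of_nat (card (P (part u))) * f v else 0)
      + (\<Sum>v\<in>A \<union> V. if u = v then (if u \<in> A then - 1 else 1) * f v else 0)"
    by (simp only: sum.distrib)
  also have "(\<Sum>v\<in>A \<union> V. if u = v then (if u \<in> A then - 1 else 1) * f v else 0)
      = (if u \<in> A then - f u else f u)"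
    using fin assms(2) by simp
  also have "(\<Sum>v\<in>A \<union> V. if u \<in> A \<and> v \<in> A \<and> part u = part v then 2 / of_nat (card (P (part u))) * f v else 0)
      = (if u \<in> A then 2 / of_nat (card (P (part u))) * (\<Sum>v\<in>P (part u). f v) else 0)"
  proof (cases "u \<in> A")
    case True
    have "(A \<union> V) \<inter> {v. v \<in> A \<and> part u = part v} = P (part u)" by (auto simp: part_of_def)
    then show ?thesis using True fin by (simp add: sum.If_cases sum_distrib_left)
  qed simp
  finally show ?thesis by simp
qed

lemma card_P_pos: "a \<in> P i \<Longrightarrow> (of_nat (card (P i)) :: complex) \<noteq> 0"
  using S.finite_P by auto

lemma q_orth:
  assumes "finite V" "u \<in> A \<union> V" "w \<in> A \<union> V"
  shows "(\<Sum>v\<in>A \<union> V. q u v * q w v) = (if u = w then 1 else 0)"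
proof (cases "u \<in> A")
  case False
  have "q w u = (if u = w then 1 else 0)" using False by (auto simp: q_def)
  then show ?thesis using sum_q[OF assms(1,2), of "q w"] False by simp
next
  case True
  let ?n = "of_nat (card (P (part u))) :: complex"
  have uP: "u \<in> P (part u)" using True by (simp add: part_of_def)
  have mem: "v \<in> P (part u) \<longleftrightarrow> v \<in> A \<and> part v = part u" for v
    by (simp add: part_of_def)
  have q: "q w v = (if w \<in> P (part u) then 2 / ?n else 0) - (if w = v then 1 else 0)"
    if "v \<in> P (part u)" for v
  proof (cases "w \<in> P (part u)")
    case True
    then have "part w = part u" "w \<in> A" "part v = part u" "v \<in> A" using that mem by simp_all
    then show ?thesis using True unfolding q_def by simp
  next
    case False
    then have n: "\<not> (w \<in> A \<and> v \<in> A \<and> part w = part v)" "w \<noteq> v" using that mem by auto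
    show ?thesis using False n(2) unfolding q_def if_not_P[OF n(1)] by simp
  qed
  have "(\<Sum>v\<in>P (part u). q w v) =
      (\<Sum>v\<in>P (part u). (if w \<in> P (part u) then 2 / ?n else 0) - (if w = v then 1 else 0))"
    by (intro sum.cong q refl)
  \<comment> \<open>Within a part of size \<open>n\<close> a row of \<open>q\<close> sums to
    \<open>n * (2 / n) - 1 = 1\<close>.\<close>
  also have "\<dots> = (if w \<in> P (part u) then 1 else 0)"
    using S.finite_P[of "part u"] card_P_pos[OF uP] by (simp add: sum_subtractf)
  finally have "(\<Sum>v\<in>A \<union> V. q u v * q w v) =
      2 / ?n * (if w \<in> P (part u) then 1 else 0) - q w u"
    using sum_q[OF assms(1,2), of "q w"] True by (simp only: if_True)
  also have "\<dots> = (if u = w then 1 else 0)"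
    unfolding q[OF uP] by simp
  finally show ?thesis .
qed

lemma D_sym: "D u v = D v u" and D'_sym: "D' u v = D' v u"
  by (rule rel_dist_sym[OF S.sym_E], rule rel_dist_sym[OF S'.sym_E])

text \<open>Twice the mean minus the old distance is the new distance, so the reflection turns
  \<open>D b\<close> into \<open>D' b\<close> on each part. For the part of \<open>b\<close> this is
  \<open>dist_V_part\<close>; on other parts both distances are one constant.\<close>

lemma mean_dist_V:
  assumes "a \<in> A" "b \<in> V"
  shows "2 / of_nat (card (P (part a))) * (\<Sum>v\<in>P (part a). of_nat (D b v))
      = (of_nat (D b a + D' b a) :: complex)"
proof -
  have aP: "a \<in> P (part a)" using assms by (simp add: part_of_def)
  have "2 * (\<Sum>v\<in>P (part a). D b v) = card (P (part a)) * (D b a + D' b a)"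
  proof (cases "part a = part b")
    case True
    then show ?thesis using dist_V_part[OF assms(2)] aP by simp
  next
    case False
    then have D: "D b v = D' b a" if "v \<in> P (part a)" for v
      using dist_V_A[OF assms(2) _ assms(1), of v] that by (simp add: part_of_def)
    show ?thesis using D[OF aP] sum.cong[OF refl D, of "P (part a)" "\<lambda>v. v"] by simp
  qed
  then have "of_nat (2 * (\<Sum>v\<in>P (part a). D b v)) =
      (of_nat (card (P (part a)) * (D b a + D' b a)) :: complex)"
    by (simp only:)
  then have "2 * (\<Sum>v\<in>P (part a). of_nat (D b v)) =
      of_nat (card (P (part a))) * (of_nat (D b a + D' b a) :: complex)"
    by (simp only: of_nat_mult of_nat_sum of_nat_numeral)
  then show ?thesis using card_P_pos[OF aP] by (simp add: field_simps)
qed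

lemma q_intertwines:
  assumes "finite V" and u: "u \<in> A \<union> V" and w: "w \<in> A \<union> V"
  shows "(\<Sum>v\<in>A \<union> V. q u v * of_nat (D' v w)) = (\<Sum>v\<in>A \<union> V. of_nat (D u v) * q v w)"
proof -
  \<comment> \<open>Symmetry of \<open>q\<close> puts it on the left, so that \<open>sum_q\<close>
    evaluates both sides.\<close>
  have R: "(\<Sum>v\<in>A \<union> V. of_nat (D u v) * q v w) =
      (\<Sum>v\<in>A \<union> V. q w v * of_nat (D u v))"
    by (intro sum.cong refl) (subst q_sym, rule mult.commute)
  have part_V: "2 / of_nat (card (P (part a))) * (\<Sum>v\<in>P (part a). of_nat (D b v))
      = (of_nat (D b a + D' b a) :: complex)" if "a \<in> A" "b \<in> V" for a b
    using that by (rule mean_dist_V)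
  have part_V': "2 / of_nat (card (P (part a))) * (\<Sum>v\<in>P (part a). of_nat (D' b v))
      = (of_nat (D' b a + D b a) :: complex)" if "a \<in> A" "b \<in> V" for a b
    using that by (rule switching_pair.mean_dist_V[OF switching_pair_swap])
  \<comment> \<open>The case of two base vertices. In one part the row sums agree; between different
    parts the distance is constant, so both sides are twice that constant.\<close>
  have sum_A: "2 / of_nat (card (P (part a))) * (\<Sum>v\<in>P (part a). of_nat (D a' v))
      = (2 / of_nat (card (P (part a'))) * (\<Sum>v\<in>P (part a'). of_nat (D a v)) :: complex)"
    if "a \<in> A" "a' \<in> A" for a a'
  proof (cases "part a = part a'")
    case True
    have "(\<Sum>v\<in>P (part x). D x v) + d (part x) + 2 = 2 * card (P (part x))" if "x \<in> A" for x
    proof -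
      have "(\<Sum>v\<in>P (part x). D x v) = (\<Sum>v\<in>P (part x). rel_dist EA x v)"
        using S.dist_A_A that by (intro sum.cong) (auto simp: part_of_def)
      then show ?thesis using S.dist_part_sum[OF that] by (simp only:)
    qed
    from this[OF that(1)] this[OF that(2)]
    have "(\<Sum>v\<in>P (part a). D a v) = (\<Sum>v\<in>P (part a). D a' v)"
      unfolding True by linarith
    then have "(\<Sum>v\<in>P (part a). of_nat (D a v)) = (\<Sum>v\<in>P (part a). of_nat (D a' v) :: complex)"
      by (simp only: flip: of_nat_sum)
    then show ?thesis unfolding True by (simp only:)
  next
    case False
    have 1: "D a' v = D a' a" if "v \<in> P (part a)" for v
      using S.dist_parts_const[of a' a' v a] S.dist_A_A that \<open>a \<in> A\<close> \<open>a' \<in> A\<close> False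
      by (simp add: part_of_def)
    have 2: "D a v = D a' a" if "v \<in> P (part a')" for v
      unfolding D_sym[of a' a]
      using S.dist_parts_const[of a a v a'] S.dist_A_A that \<open>a \<in> A\<close> \<open>a' \<in> A\<close> False
      by (simp add: part_of_def)
    have "(\<Sum>v\<in>P (part a). of_nat (D a' v)) = (of_nat (card (P (part a))) * of_nat (D a' a) :: complex)"
      "(\<Sum>v\<in>P (part a'). of_nat (D a v)) = (of_nat (card (P (part a'))) * of_nat (D a' a) :: complex)"
      using 1 2 by simp_all
    moreover have "a \<in> P (part a)" "a' \<in> P (part a')" using that by (simp_all add: part_of_def)
    ultimately show ?thesis using card_P_pos[of a "part a"] card_P_pos[of a' "part a'"] by simp
  qed
  have D'_A: "D' v x = D x v" if "v \<in> A" "x \<in> A" for v x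
    using S.dist_A_A[OF that] S'.dist_A_A[OF that] D_sym[of v x] by simp
  consider "u \<in> A" "w \<in> A" | "u \<in> A" "w \<in> V" "w \<notin> A" | "u \<in> V" "u \<notin> A" "w \<in> A" | "u \<in> V" "w \<in> V"
      "u \<notin> A" "w \<notin> A"
    using u w S.disj by blast
  then show ?thesis
  proof cases
    case 1
    have "(\<Sum>v\<in>P (part u). of_nat (D' v w)) = (\<Sum>v\<in>P (part u). of_nat (D w v) :: complex)"
      using D'_A 1 by (intro sum.cong) (auto simp: part_of_def)
    then show ?thesis
      unfolding R sum_q[OF assms(1) u] sum_q[OF assms(1) w]
      using 1 sum_A[OF 1] D'_A[OF 1] D_sym[of w u] by simp
  next
    case 2
    have "(\<Sum>v\<in>P (part u). of_nat (D' v w)) = (\<Sum>v\<in>P (part u). of_nat (D' w v) :: complex)"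
      by (intro sum.cong refl) (subst D'_sym, rule refl)
    then show ?thesis
      unfolding R sum_q[OF assms(1) u] sum_q[OF assms(1) w]
      using 2 part_V'[OF 2(1,2)] D'_sym[of u w] D_sym[of u w] by simp
  next
    case 3
    then show ?thesis
      unfolding R sum_q[OF assms(1) u] sum_q[OF assms(1) w]
      using part_V[OF 3(3,1)] by simp
  next
    case 4
    then show ?thesis
      unfolding R sum_q[OF assms(1) u] sum_q[OF assms(1) w] using dist_V_V by simp
  qed
qed

lemma distance_char_poly_eq:
  assumes "finite V" "distinct vs" "set vs = A \<union> V" "distinct ws" "set ws = A \<union> V"
  shows "char_poly (mat (length vs) (length vs) (\<lambda>(i, j). of_nat (D (vs ! i) (vs ! j)) :: complex)) =
    char_poly (mat (length ws) (length ws) (\<lambda>(i, j). of_nat (D' (ws ! i) (ws ! j)) :: complex))"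
  by (rule char_poly_eq_if_intertwined[where q = q, OF assms(2-5) q_orth[OF assms(1)]
        q_intertwines[OF assms(1)]])

end

section \<open>Cospectrality\<close>

theorem theorem2p4:
  fixes A G1 G2 :: "'v pair_pre_digraph"
    and m :: nat
    and l d :: "nat \<Rightarrow> nat"
    and P :: "nat \<Rightarrow> 'v set"
    and B :: "nat \<Rightarrow> nat \<Rightarrow> 'v pair_pre_digraph"
    and H :: "nat \<Rightarrow> nat \<Rightarrow> 'v set"
  assumes A: "pair_graph A" "Digraph_Component.connected (with_proj A)"
    and partition: "partition_on (pverts A) (P ` {1..m})" "inj_on P {1..m}"
    and parts_even: "\<And>i. i \<in> {1..m} \<Longrightarrow> even (card (P i))"
    and parts_regular: "\<And>i. i \<in> {1..m} \<Longrightarrow> regular_graph (with_proj A \<restriction> P i) (d i)"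
    and parts_degree: "\<And>i. i \<in> {1..m} \<Longrightarrow> real (d i) \<ge> real (card (P i)) / 2"
    and parts_adjacent: "\<And>i j a. i \<in> {1..m} \<Longrightarrow> j \<in> {1..m} \<Longrightarrow> j \<noteq> i \<Longrightarrow> a \<in> P i \<Longrightarrow>
          P j \<subseteq> neighbors A a \<or> P j \<inter> neighbors A a = {}"
    and B: "\<And>i j. i \<in> {1..m} \<Longrightarrow> j \<in> {1..l i} \<Longrightarrow>
          pair_graph (B i j) \<and> Digraph_Component.connected (with_proj (B i j))"
    and B_disjoint: "disjoint_family_on (\<lambda>(i, j). pverts (B i j)) (SIGMA i:{1..m}. {1..l i})"
    and B_A_disjoint: "\<And>i j. i \<in> {1..m} \<Longrightarrow> j \<in> {1..l i} \<Longrightarrow> pverts (B i j) \<inter> pverts A = {}"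
    and halves: "\<And>i j. i \<in> {1..m} \<Longrightarrow> j \<in> {1..l i} \<Longrightarrow>
          H i j \<subseteq> P i \<and> real (card (H i j)) = real (card (P i)) / 2"
    and G1: "pair_graph G1" "Digraph_Component.connected (with_proj G1)"
    and G1_verts: "pverts G1 = pverts A \<union> (\<Union>i\<in>{1..m}. \<Union>j\<in>{1..l i}. pverts (B i j))"
    and G1_arcs_lower: "parcs A \<union> (\<Union>i\<in>{1..m}. \<Union>j\<in>{1..l i}. parcs (B i j)) \<subseteq> parcs G1"
    and G1_arcs_upper: "parcs G1 \<subseteq> parcs A \<union> (\<Union>i\<in>{1..m}. \<Union>j\<in>{1..l i}. parcs (B i j))
          \<union> sym_arcs (\<Union>i\<in>{1..m}. \<Union>j\<in>{1..l i}. pverts (B i j) \<times> P i)"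
    and G1_attach: "\<And>i j b. i \<in> {1..m} \<Longrightarrow> j \<in> {1..l i} \<Longrightarrow> b \<in> pverts (B i j) \<Longrightarrow>
          neighbors G1 b \<inter> P i \<in> {{}, P i, H i j}"
    and G2: "G2 = switched_graph m l P B H G1" "Digraph_Component.connected (with_proj G2)"
  shows "distance_cospectral G1 G2"
proof -
  define V where "V = (\<Union>i\<in>{1..m}. \<Union>j\<in>{1..l i}. pverts (B i j))"
  define EB where "EB = (\<Union>i\<in>{1..m}. \<Union>j\<in>{1..l i}. parcs (B i j))"
  \<comment> \<open>The pair of indices of the attached graph containing \<open>b\<close>, unique
    because these graphs are disjoint.\<close>
  define idx where "idx b = (SOME ij. ij \<in> (SIGMA i:{1..m}. {1..l i}) \<and>
    b \<in> (case ij of (i, j) \<Rightarrow> pverts (B i j)))" for b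
  define part where
    "part v = (if v \<in> pverts A then SOME i. i \<in> {1..m} \<and> v \<in> P i else fst (idx v))" for v
  define H1 where "H1 b = (case idx b of (i, j) \<Rightarrow> H i j)" for b
  define F where "F = {b \<in> V. neighbors G1 b \<inter> P (part b) = P (part b)}"
  define T where "T = {b \<in> V. neighbors G1 b \<inter> P (part b) = H1 b}"
  \<comment> \<open>Written with \<open>part_of\<close> for all \<open>b\<close>, to match the
    complement in \<open>switching_pair_complement\<close> literally; on \<open>V\<close> it is
    \<open>P (part b) - H1 b\<close>.\<close>
  define H2 where "H2 b = part_of (pverts A) part (part b) - H1 b" for b

  interpret A: pair_graph A by fact
  interpret G1: pair_graph G1 by fact
  have sym_A: "sym (parcs A)" and sym_G1: "sym (parcs G1)"
    using A.pair_sym_arcs G1.pair_sym_arcs by (simp_all add: symmetric_def)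

  \<comment> \<open>Parts, indices and halves read off from the hypotheses\<close>
  have idx_eq: "idx b = (i, j)" if "i \<in> {1..m}" "j \<in> {1..l i}" "b \<in> pverts (B i j)" for b i j
    unfolding idx_def
  proof (rule some_equality)
    fix ij assume *: "ij \<in> (SIGMA i:{1..m}. {1..l i}) \<and> b \<in> (case ij of (i, j) \<Rightarrow> pverts (B i j))"
    show "ij = (i, j)"
    proof (rule ccontr)
      assume "ij \<noteq> (i, j)"
      then have "(case ij of (i, j) \<Rightarrow> pverts (B i j)) \<inter> (case (i, j) of (i, j) \<Rightarrow> pverts (B i j)) = {}"
        using * that(1,2) by (intro disjoint_family_onD[OF B_disjoint]) auto
      then show False using * that(3) by auto
    qed
  qed (use that in auto)
  have P_sub: "P i \<subseteq> pverts A" and P_ne: "P i \<noteq> {}" if "i \<in> {1..m}" for i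
    using partition_onD1[OF partition(1)] partition_onD3[OF partition(1)] that by auto
  have A_P: "\<exists>i\<in>{1..m}. v \<in> P i" if "v \<in> pverts A" for v
    using partition_onD1[OF partition(1)] that by auto
  have P_unique: "i = j" if "i \<in> {1..m}" "j \<in> {1..m}" "v \<in> P i" "v \<in> P j" for i j v
  proof (rule ccontr)
    assume "i \<noteq> j"
    then have "P i \<noteq> P j" using partition(2) that(1,2) by (auto dest: inj_onD)
    then have "P i \<inter> P j = {}"
      using that(1,2) by (intro disjointD[OF partition_onD2[OF partition(1)]]) auto
    then show False using that(3,4) by blast
  qed
  have part_P: "part v = i" if "i \<in> {1..m}" "v \<in> P i" for v i
  proof -
    have "(SOME i. i \<in> {1..m} \<and> v \<in> P i) = i"
    proof (rule some_equality)
      show "i \<in> {1..m} \<and> v \<in> P i" using that by simp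
      show "i' = i" if "i' \<in> {1..m} \<and> v \<in> P i'" for i'
        using P_unique[of i' i v] that \<open>i \<in> {1..m}\<close> \<open>v \<in> P i\<close> by blast
    qed
    then show ?thesis using P_sub[OF that(1)] that(2) unfolding part_def by auto
  qed
  have part_A: "part v \<in> {1..m}" "v \<in> P (part v)" if "v \<in> pverts A" for v
  proof -
    obtain i where i: "i \<in> {1..m}" "v \<in> P i" using A_P[OF \<open>v \<in> pverts A\<close>] by blast
    then show "part v \<in> {1..m}" "v \<in> P (part v)" using part_P[OF i] by simp_all
  qed
  have part_of: "part_of (pverts A) part i = P i" if "i \<in> {1..m}" for i
    unfolding part_of_def using part_P[OF that] P_sub[OF that] part_A(2) by blast
  have V_disj: "pverts A \<inter> V = {}" using B_A_disjoint unfolding V_def by blast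
  have part_B: "part b = i" and H1_B: "H1 b = H i j"
    if "i \<in> {1..m}" "j \<in> {1..l i}" "b \<in> pverts (B i j)" for b i j
    using idx_eq[OF that] B_A_disjoint[OF that(1,2)] that(3) unfolding part_def H1_def by auto
  have V_cases: "\<exists>i\<in>{1..m}. \<exists>j\<in>{1..l i}. b \<in> pverts (B i j) \<and> part b = i \<and> H1 b = H i j"
    if "b \<in> V" for b
    using that part_B H1_B unfolding V_def by blast
  have part_V: "part b \<in> {1..m}" if "b \<in> V" for b
    using V_cases[OF that] by blast
  have finite_P: "finite (P i)" if "i \<in> {1..m}" for i
    using P_sub[OF that] A.pair_finite_verts by (rule finite_subset)
  have H1_half: "H1 b \<subseteq> P (part b)" "2 * card (H1 b) = card (P (part b))" if "b \<in> V" for b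
  proof -
    obtain i j where ij: "i \<in> {1..m}" "j \<in> {1..l i}" "part b = i" "H1 b = H i j"
      using V_cases[OF \<open>b \<in> V\<close>] by blast
    have "real (2 * card (H i j)) = real (card (P i))" using halves[OF ij(1,2)] by simp
    then show "2 * card (H1 b) = card (P (part b))" unfolding ij(3,4) of_nat_eq_iff .
    show "H1 b \<subseteq> P (part b)" unfolding ij(3,4) using halves[OF ij(1,2)] by blast
  qed
  \<comment> \<open>A half of a nonempty part is proper, which makes \<open>F\<close> and
    \<open>T\<close> disjoint.\<close>
  have H1_proper: "H1 b \<noteq> P (part b)" if "b \<in> V" for b
  proof -
    have "card (P (part b)) > 0"
      using finite_P P_ne part_V[OF that] by (simp add: card_gt_0_iff)
    then show ?thesis using H1_half(2)[OF that] by auto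
  qed
  have FT_disj: "F \<inter> T = {}" using H1_proper unfolding F_def T_def by auto
  have FT_sub: "F \<subseteq> V" "T \<subseteq> V" unfolding F_def T_def by auto

  \<comment> \<open>The arc sets of both graphs as instances of \<open>attached_arcs\<close>\<close>
  have EA_sub: "parcs A \<subseteq> pverts A \<times> pverts A" using A.wellformed' by auto
  have B_wf: "parcs (B i j) \<subseteq> pverts (B i j) \<times> pverts (B i j)" "sym (parcs (B i j))"
    if "i \<in> {1..m}" "j \<in> {1..l i}" for i j
  proof -
    interpret B: pair_graph "B i j" using B[OF that] by blast
    show "parcs (B i j) \<subseteq> pverts (B i j) \<times> pverts (B i j)" using B.wellformed' by auto
    show "sym (parcs (B i j))" using B.pair_sym_arcs by (simp add: symmetric_def)
  qed
  have EB_sub: "EB \<subseteq> V \<times> V" using B_wf(1) unfolding EB_def V_def by blast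
  have sym_EB: "sym EB"
  proof (rule symI)
    fix b b' assume "(b, b') \<in> EB"
    then obtain i j where ij: "i \<in> {1..m}" "j \<in> {1..l i}" "(b, b') \<in> parcs (B i j)"
      unfolding EB_def by blast
    then show "(b', b) \<in> EB" using symD[OF B_wf(2)[OF ij(1,2)] ij(3)] unfolding EB_def by blast
  qed

  let ?full = "{(b, a). b \<in> F \<and> a \<in> P (part b)}"
  have attached: "attached_arcs (pverts A) part (parcs A) EB F T K =
      parcs A \<union> EB \<union> sym_arcs ?full \<union> sym_arcs {(b, a). b \<in> T \<and> a \<in> K b}"
    if "\<And>b. b \<in> V \<Longrightarrow> K b \<subseteq> P (part b)" for K
  proof -
    have "a \<in> pverts A \<and> part a = part b \<longleftrightarrow> a \<in> P (part b)" if "b \<in> V" for a b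
      using part_of[OF part_V[OF that]] by (auto simp: part_of_def)
    then have "{(b, a). a \<in> pverts A \<and> part a = part b \<and> (b \<in> F \<or> b \<in> T \<and> a \<in> K b)} =
        ?full \<union> {(b, a). b \<in> T \<and> a \<in> K b}"
      using FT_sub that by blast
    then show ?thesis unfolding attached_arcs_def sym_arcs_def by auto
  qed
  have attached1: "attached_arcs (pverts A) part (parcs A) EB F T H1 =
      parcs A \<union> EB \<union> sym_arcs ?full \<union> sym_arcs {(b, a). b \<in> T \<and> a \<in> H1 b}"
    by (rule attached) (rule H1_half(1))
  have nb_G1: "(b, a) \<in> parcs G1 \<longleftrightarrow> b \<in> F \<or> b \<in> T \<and> a \<in> H1 b" if "b \<in> V" "a \<in> P (part b)" for b a
  proof -
    obtain i j where ij: "i \<in> {1..m}" "j \<in> {1..l i}" "b \<in> pverts (B i j)" "part b = i" "H1 b = H i j"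
      using V_cases[OF \<open>b \<in> V\<close>] by blast
    have "neighbors G1 b \<inter> P (part b) \<in> {{}, P (part b), H1 b}"
      using G1_attach[OF ij(1-3)] ij(4,5) by simp
    then show ?thesis using that unfolding F_def T_def neighbors_def by auto
  qed
  have arcs1: "parcs G1 = attached_arcs (pverts A) part (parcs A) EB F T H1"
  proof -
    let ?R = "{(b, a). b \<in> T \<and> a \<in> H1 b}"
    have "parcs G1 \<subseteq> parcs A \<union> EB \<union> sym_arcs (?full \<union> ?R)"
    proof (rule subrelI)
      fix u v assume uv: "(u, v) \<in> parcs G1"
      then have vu: "(v, u) \<in> parcs G1" using sym_G1 by (auto dest: symD)
      \<comment> \<open>Applied to both orientations, since the symmetric bound on the arcs does not
        tell which end is attached.\<close>
      have *: "(b, a) \<in> ?full \<union> ?R" if "(b, a) \<in> parcs G1"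
          "(b, a) \<in> (\<Union>i\<in>{1..m}. \<Union>j\<in>{1..l i}. pverts (B i j) \<times> P i)" for b a
      proof -
        obtain i j where ij: "i \<in> {1..m}" "j \<in> {1..l i}" "b \<in> pverts (B i j)" "a \<in> P i"
          using \<open>(b, a) \<in> (\<Union>i\<in>{1..m}. _ i)\<close> by blast
        then have "b \<in> V" "a \<in> P (part b)" using part_B[OF ij(1-3)] unfolding V_def by blast+
        then show ?thesis using nb_G1 that(1) by auto
      qed
      show "(u, v) \<in> parcs A \<union> EB \<union> sym_arcs (?full \<union> ?R)"
        using subsetD[OF G1_arcs_upper uv] *[OF uv] *[OF vu] unfolding sym_arcs_def EB_def by blast
    qed
    moreover have "?full \<union> ?R \<subseteq> parcs G1"
      using nb_G1 FT_sub H1_half(1) by blast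
    then have "sym_arcs (?full \<union> ?R) \<subseteq> parcs G1"
      using sym_G1 unfolding sym_arcs_def by (auto dest: symD)
    ultimately have "parcs G1 = parcs A \<union> EB \<union> sym_arcs (?full \<union> ?R)"
      using G1_arcs_lower unfolding EB_def by blast
    also have "\<dots> = attached_arcs (pverts A) part (parcs A) EB F T H1"
      unfolding attached1 sym_arcs_def by blast
    finally show ?thesis .
  qed
  have H2_P: "H2 b = P (part b) - H1 b" if "b \<in> V" for b
    using part_of[OF part_V[OF that]] by (simp add: H2_def)
  have half_T: "b \<in> half_vertices G1 (pverts (B i j)) (P i) (H i j) \<longleftrightarrow> b \<in> T \<and> b \<in> pverts (B i j)"
    if "i \<in> {1..m}" "j \<in> {1..l i}" for i j b
  proof (cases "b \<in> pverts (B i j)")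
    case True
    then have "b \<in> V" using that unfolding V_def by blast
    then show ?thesis
      using part_B[OF that True] H1_B[OF that True] True by (simp add: half_vertices_def T_def)
  qed (simp add: half_vertices_def)
  \<comment> \<open>\<open>K\<close> stands for the selected half in the removed arcs and for its
    complement in the added ones.\<close>
  have UN_half: "(\<Union>i\<in>{1..m}. \<Union>j\<in>{1..l i}. half_vertices G1 (pverts (B i j)) (P i) (H i j) \<times> K i j) =
      {(b, a). b \<in> T \<and> a \<in> K' b}" (is "?L = ?R")
    if K: "\<And>i j b. i \<in> {1..m} \<Longrightarrow> j \<in> {1..l i} \<Longrightarrow> b \<in> pverts (B i j) \<Longrightarrow> K' b = K i j" for K K'
  proof (intro equalityI subrelI)
    fix b a assume "(b, a) \<in> ?L"
    then obtain i j where ij: "i \<in> {1..m}" "j \<in> {1..l i}" "a \<in> K i j"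
        "b \<in> half_vertices G1 (pverts (B i j)) (P i) (H i j)"
      by blast
    then show "(b, a) \<in> ?R" using half_T[OF ij(1,2)] K[OF ij(1,2)] by simp
  next
    fix b a assume "(b, a) \<in> ?R"
    then have ba: "b \<in> T" "a \<in> K' b" by simp_all
    then obtain i j where ij: "i \<in> {1..m}" "j \<in> {1..l i}" "b \<in> pverts (B i j)"
      using V_cases FT_sub(2) by blast
    then have "a \<in> K i j" "b \<in> half_vertices G1 (pverts (B i j)) (P i) (H i j)"
      using ba half_T[OF ij(1,2)] K[OF ij] by simp_all
    then show "(b, a) \<in> ?L" using ij by blast
  qed
  have removed: "(\<Union>i\<in>{1..m}. \<Union>j\<in>{1..l i}.
      half_vertices G1 (pverts (B i j)) (P i) (H i j) \<times> H i j) = {(b, a). b \<in> T \<and> a \<in> H1 b}"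
    by (rule UN_half[OF H1_B])
  have added: "(\<Union>i\<in>{1..m}. \<Union>j\<in>{1..l i}.
      half_vertices G1 (pverts (B i j)) (P i) (H i j) \<times> (P i - H i j)) = {(b, a). b \<in> T \<and> a \<in> H2 b}"
  proof (rule UN_half)
    fix i j b assume ij: "i \<in> {1..m}" "j \<in> {1..l i}" "b \<in> pverts (B i j)"
    then have "b \<in> V" unfolding V_def by blast
    then show "H2 b = P i - H i j" using H2_P part_B[OF ij] H1_B[OF ij] by simp
  qed
  have arcs2: "parcs G2 = attached_arcs (pverts A) part (parcs A) EB F T H2"
  proof -
    let ?R = "{(b, a). b \<in> T \<and> a \<in> H1 b}"
    have full_VA: "?full \<subseteq> V \<times> pverts A" and R_VA: "?R \<subseteq> V \<times> pverts A"
      using FT_sub H1_half(1) P_sub part_V by blast+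
    have "?full \<inter> ?R = {}" using FT_disj by blast
    \<comment> \<open>Removed arcs run between \<open>V\<close> and \<open>A\<close>, so they avoid
      \<open>parcs A\<close> and \<open>EB\<close>; disjointness of \<open>F\<close> and
      \<open>T\<close> keeps them apart from the full attachments. Deletion thus leaves exactly the
      other three families.\<close>
    then have "(parcs A \<union> EB \<union> sym_arcs ?full) \<inter> sym_arcs ?R = {}"
      using EA_sub EB_sub full_VA R_VA V_disj unfolding sym_arcs_def by blast
    then have "parcs G1 - sym_arcs ?R = parcs A \<union> EB \<union> sym_arcs ?full"
      unfolding arcs1 attached1 by blast
    moreover have "attached_arcs (pverts A) part (parcs A) EB F T H2 =
        parcs A \<union> EB \<union> sym_arcs ?full \<union> sym_arcs {(b, a). b \<in> T \<and> a \<in> H2 b}"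
      by (rule attached) (use H2_P in blast)
    ultimately show ?thesis
      unfolding G2(1) switched_graph_def removed added by simp
  qed

  have verts1: "pverts G1 = pverts A \<union> V" using G1_verts unfolding V_def .
  then have verts2: "pverts G2 = pverts A \<union> V" unfolding G2(1) switched_graph_def by simp
  have sym_G2: "sym (parcs G2)" unfolding arcs2 using sym_A sym_EB by (rule sym_attached_arcs)
  have wf_G2: "pair_wf_digraph G2"
  proof -
    have "parcs G2 \<subseteq> (pverts A \<union> V) \<times> (pverts A \<union> V)"
      using EA_sub EB_sub FT_sub unfolding arcs2 attached_arcs_def sym_arcs_def by auto
    then show ?thesis unfolding pair_wf_digraph_def verts2 by auto
  qed
  have wf_G1: "pair_wf_digraph G1" ..

  \<comment> \<open>Verification of the switching conditions, and conclusion\<close>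
  interpret switch: switching "pverts A" V part d "parcs A" EB F T H1
  proof
    show "finite (pverts A)" by (rule A.pair_finite_verts)
    show "irrefl (parcs A)" using A.pair_no_loops by (force simp: irrefl_def)
    show "part b = part b'" "H1 b = H1 b'" if "(b, b') \<in> EB" for b b'
    proof -
      obtain i j where ij: "i \<in> {1..m}" "j \<in> {1..l i}" "(b, b') \<in> parcs (B i j)"
        using \<open>(b, b') \<in> EB\<close> unfolding EB_def by blast
      then have "b \<in> pverts (B i j)" "b' \<in> pverts (B i j)" using B_wf(1) by blast+
      then show "part b = part b'" "H1 b = H1 b'"
        using part_B[OF ij(1,2)] H1_B[OF ij(1,2)] by simp_all
    qed
    show "(a2, a') \<in> parcs A"
      if "(a, a') \<in> parcs A" "part a \<noteq> part a'" "a2 \<in> pverts A" "part a2 = part a" for a a' a2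
    proof -
      have a: "a \<in> pverts A" "a' \<in> pverts A" using that(1) EA_sub by blast+
      \<comment> \<open>The all-or-none condition is used at \<open>a'\<close>: one neighbour in the
        part of \<open>a\<close> forces the whole part, including \<open>a2\<close>.\<close>
      have "a \<in> P (part a) \<inter> neighbors A a'"
        using part_A(2)[OF a(1)] symD[OF sym_A that(1)] by (simp add: neighbors_def)
      then have "P (part a) \<subseteq> neighbors A a'"
        using parts_adjacent[OF part_A(1)[OF a(2)] part_A(1)[OF a(1)] that(2) part_A(2)[OF a(2)]]
        by blast
      then have "(a', a2) \<in> parcs A"
        using part_A(2)[OF that(3)] that(4) by (auto simp: neighbors_def)
      then show ?thesis using sym_A by (auto dest: symD)
    qed
    show "card {a' \<in> part_of (pverts A) part (part a). (a, a') \<in> parcs A} = d (part a)"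
      if "a \<in> pverts A" for a
    proof -
      note i = part_A[OF that]
      have "out_degree (with_proj A \<restriction> P (part a)) a = d (part a)"
        using parts_regular[OF i(1)] i(2) unfolding regular_graph_def by simp
      moreover have "out_arcs (with_proj A \<restriction> P (part a)) a =
          Pair a ` {a' \<in> P (part a). (a, a') \<in> parcs A}"
        using i(2) unfolding out_arcs_def by auto
      ultimately show ?thesis
        unfolding part_of[OF i(1)] out_degree_def by (simp add: card_image inj_on_def)
    qed
    show "card (part_of (pverts A) part (part a)) \<le> 2 * d (part a)" if "a \<in> pverts A" for a
    proof -
      have "real (card (P (part a))) \<le> real (2 * d (part a))"
        using parts_degree[OF part_A(1)[OF that]] by simp
      then show ?thesis unfolding part_of[OF part_A(1)[OF that]] of_nat_le_iff .
    qed
    show "H1 b \<subseteq> part_of (pverts A) part (part b)"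
      "2 * card (H1 b) = card (part_of (pverts A) part (part b))"
      "part_of (pverts A) part (part b) \<noteq> {}" if "b \<in> V" for b
      unfolding part_of[OF part_V[OF that]]
      using H1_half[OF that] P_ne[OF part_V[OF that]] by simp_all
    show "(a, a') \<in> (parcs A)\<^sup>*" if "a \<in> pverts A" "a' \<in> pverts A" for a a'
      using connected_imp_rtrancl[OF _ sym_A A(2) that] by blast
    show "(u, v) \<in> (attached_arcs (pverts A) part (parcs A) EB F T H1)\<^sup>*"
      if "u \<in> pverts A \<union> V" "v \<in> pverts A \<union> V" for u v
      using connected_imp_rtrancl[OF wf_G1 sym_G1 G1(2)] that unfolding verts1 arcs1 .
  qed (fact V_disj EA_sub sym_A EB_sub sym_EB FT_sub)+
  interpret pair: switching_pair "pverts A" V part d "parcs A" EB F T H1 H2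
    unfolding H2_def
  proof (rule switch.switching_pair_complement)
    show "(u, v) \<in> (attached_arcs (pverts A) part (parcs A) EB F T
        (\<lambda>b. part_of (pverts A) part (part b) - H1 b))\<^sup>*"
      if "u \<in> pverts A \<union> V" "v \<in> pverts A \<union> V" for u v
      using connected_imp_rtrancl[OF wf_G2 sym_G2 G2(2)] that
      unfolding verts2 arcs2 H2_def[abs_def] .
  qed
  have "finite V" using G1.pair_finite_verts unfolding verts1 by simp
  show ?thesis
    unfolding distance_cospectral_def
  proof (intro allI impI)
    fix vs ws assume vs: "vertex_enumeration G1 vs" and ws: "vertex_enumeration G2 ws"
    then show "eigenvalue_mset (distance_matrix G1 vs) = eigenvalue_mset (distance_matrix G2 ws)"
      using pair.distance_char_poly_eq[OF \<open>finite V\<close>, of vs ws]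
        distance_matrix_eq_rel_dist[OF wf_G1 sym_G1 G1(2), of vs]
        distance_matrix_eq_rel_dist[OF wf_G2 sym_G2 G2(2), of ws]
      unfolding vertex_enumeration_def eigenvalue_mset_def verts1 verts2 arcs1 arcs2 by simp
  qed
qed

end
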